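(* Every complete improper affine front in $\mathbb{R}^3$ with total curvature $0$ is, up to equivalence, the elliptic paraboloid, i.e. the improper affine front defined on $\Sigma=(\mathbb{C}\cup\{\infty\})\setminus\{0\}$ with Weierstrass data $F=\frac1z$, $G=\frac bz$ for some $b\in\mathbb{C}$ with $|b|\neq1$.
   Context: **Improper affine fronts.** Let $\Sigma$ be a connected Riemann surface and let $F,G:\Sigma\to\mathbb{C}$ be holomorphic functions with $(dF,dG)\neq(0,0)$ everywhere, satisfying the period condition $\mathrm{Re}\int_\gamma F\,dG=0$ for every closed curve $\gamma$ in $\Sigma$. The map $$\psi=\Big(G+\overline{F},\ \tfrac12(|G|^2-|F|^2)+\mathrm{Re}\big(GF-2\int F\,dG\big)\Big):\Sigma\to\mathbb{C}\times\mathbb{R}=\mathbb{R}^3$$ is called an improper affine front with Weierstrass data $(F,G)$. The flat fundamental form is $ds^2=|dF|^2+|dG|^2+dF\,dG+\overline{dF\,dG}$. **Completeness.** $\psi$ is complete if there is a symmetric bilinear form $T$ with compact support on $\Sigma$ such that $T+ds^2$ is a complete Riemannian metric on $\Sigma$. It is known that then $\Sigma$ is biholomorphic to a compact Riemann surface minus finitely many (at least one) points, called ends, and $F,G$ extend meromorphically to the compact surface. **Total curvature.** The total curvature is $\int_\Sigma K_\tau\,dA_\tau$, where $K_\tau,dA_\tau$ are the Gaussian curvature and area element of $d\tau^2=2(|dF|^2+|dG|^2)$. It equals $-2\pi\deg\rho$, where $\rho=dF/dG$ is the Lagrangian Gauss map (a meromorphic map from the compactified surface to $\mathbb{C}\cup\{\infty\}$).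 **Equivalence.** Classification is up to biholomorphic change of the domain, the equiaffine changes of Weierstrass data $(F,G)\mapsto(\alpha F+\beta G+\mu,\ \overline{\beta}F+\overline{\alpha}G+\lambda)$ with $\alpha,\beta,\mu,\lambda\in\mathbb{C}$, $|\alpha|^2-|\beta|^2=1$, and exchange of the roles of $F$ and $G$. *)

theory Defs
  imports "HOL-Analysis.Analysis"
begin

section \<open>Riemann surfaces\<close>

text \<open>A chart is its domain together with the coordinate map, whose values off the domain
  are irrelevant.\<close>

type_synonym 'a chart = "'a set \<times> ('a \<Rightarrow> complex)"

record 'a surface =
  topo :: "'a topology"
  atlas :: "'a chart set"

abbreviation points :: "'a surface \<Rightarrow> 'a set" where
  "points S \<equiv> topspace (topo S)"

definition chart_inv :: "'a chart \<Rightarrow> complex \<Rightarrow> 'a" where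
  "chart_inv c = inv_into (fst c) (snd c)"

definition charts_at :: "'a surface \<Rightarrow> 'a \<Rightarrow> 'a chart set" where
  "charts_at S p = {c \<in> atlas S. p \<in> fst c}"

text \<open>Connected Riemann surfaces. Second countability is not demanded, since it is automatic
  by Rado's theorem.\<close>

definition riemann_surface :: "'a surface \<Rightarrow> bool" where
  "riemann_surface S \<longleftrightarrow>
     points S \<noteq> {} \<and> Hausdorff_space (topo S) \<and> connected_space (topo S) \<and>
     (\<Union>c\<in>atlas S. fst c) = points S \<and>
     (\<forall>c\<in>atlas S. openin (topo S) (fst c) \<and> open (snd c ` fst c) \<and>
        homeomorphic_map (subtopology (topo S) (fst c)) (top_of_set (snd c ` fst c)) (snd c)) \<and>
     (\<forall>c\<in>atlas S. \<forall>c'\<in>atlas S. (snd c' \<circ> chart_inv c) holomorphic_on snd c ` (fst c \<inter> fst c'))"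

definition holomorphic_fun :: "'a surface \<Rightarrow> ('a \<Rightarrow> complex) \<Rightarrow> bool" where
  "holomorphic_fun S f \<longleftrightarrow> (\<forall>c\<in>atlas S. (f \<circ> chart_inv c) holomorphic_on snd c ` fst c)"

definition holomorphic_map :: "'a surface \<Rightarrow> 'b surface \<Rightarrow> ('a \<Rightarrow> 'b) \<Rightarrow> bool" where
  "holomorphic_map S S' f \<longleftrightarrow> continuous_map (topo S) (topo S') f \<and>
     (\<forall>c\<in>atlas S. \<forall>c'\<in>atlas S'.
        (snd c' \<circ> f \<circ> chart_inv c) holomorphic_on snd c ` {p \<in> fst c. f p \<in> fst c'})"

definition biholomorphism :: "'a surface \<Rightarrow> 'b surface \<Rightarrow> ('a \<Rightarrow> 'b) \<Rightarrow> bool" where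
  "biholomorphism S S' f \<longleftrightarrow> bij_betw f (points S) (points S') \<and>
     holomorphic_map S S' f \<and> holomorphic_map S' S (inv_into (points S) f)"

definition open_subsurface :: "'a surface \<Rightarrow> 'a set \<Rightarrow> 'a surface" where
  "open_subsurface S U =
     \<lparr>topo = subtopology (topo S) U, atlas = (\<lambda>c. (fst c \<inter> U, snd c)) ` atlas S\<rparr>"

text \<open>The Riemann sphere, where the value None is the point at infinity.\<close>

definition riemann_sphere :: "complex option surface" where
  "riemann_sphere =
     \<lparr>topo = Alexandroff_compactification euclidean,
      atlas = {(range Some, the),
               (- {Some 0}, \<lambda>p. case p of None \<Rightarrow> 0 | Some z \<Rightarrow> 1 / z)}\<rparr>"

section \<open>Curves\<close>

text \<open>Piecewise continuously differentiable curves, parametrised by the unit interval.\<close>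

definition pw_curve :: "'a surface \<Rightarrow> (real \<Rightarrow> 'a) \<Rightarrow> bool" where
  "pw_curve S \<gamma> \<longleftrightarrow> pathin (topo S) \<gamma> \<and>
     (\<forall>c\<in>atlas S. \<forall>a b. 0 \<le> a \<and> a \<le> b \<and> b \<le> 1 \<and> \<gamma> ` {a..b} \<subseteq> fst c \<longrightarrow>
        (snd c \<circ> \<gamma>) piecewise_C1_differentiable_on {a..b})"

text \<open>The integral of the one-form F dG along a curve, using that G pulls back along the curve
  to a complex function of a real variable.\<close>

definition curve_integral ::
    "('a \<Rightarrow> complex) \<Rightarrow> ('a \<Rightarrow> complex) \<Rightarrow> (real \<Rightarrow> 'a) \<Rightarrow> complex" where
  "curve_integral F G \<gamma> =
     integral {0..1} (\<lambda>t. F (\<gamma> t) * vector_derivative (G \<circ> \<gamma>) (at t within {0..1}))"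

section \<open>Symmetric bilinear forms and Riemannian metrics\<close>

text \<open>A field of bilinear forms is given by its expression in each chart: the arguments are a
  chart, a point of its domain, and two tangent vectors written in the real coordinates of the
  chart, as complex numbers.\<close>

type_synonym 'a form = "'a chart \<Rightarrow> 'a \<Rightarrow> complex \<Rightarrow> complex \<Rightarrow> real"

definition chart_deriv :: "'a chart \<Rightarrow> ('a \<Rightarrow> complex) \<Rightarrow> 'a \<Rightarrow> complex" where
  "chart_deriv c f p = deriv (f \<circ> chart_inv c) (snd c p)"

primrec Ck_on :: "nat \<Rightarrow> (complex \<Rightarrow> real) \<Rightarrow> complex set \<Rightarrow> bool" where
  "Ck_on 0 f U \<longleftrightarrow> continuous_on U f"
| "Ck_on (Suc k) f U \<longleftrightarrow>
     f differentiable_on U \<and> (\<forall>v. Ck_on k (\<lambda>z. frechet_derivative f (at z) v) U)"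

text \<open>Smooth symmetric bilinear forms; the last conjunct is the transformation law under a
  change of charts.\<close>

definition sym_bilinear_form :: "'a surface \<Rightarrow> 'a form \<Rightarrow> bool" where
  "sym_bilinear_form S T \<longleftrightarrow>
     (\<forall>c\<in>atlas S. \<forall>p\<in>fst c. bilinear (T c p) \<and> (\<forall>v w. T c p v w = T c p w v)) \<and>
     (\<forall>c\<in>atlas S. \<forall>v w k. Ck_on k (\<lambda>z. T c (chart_inv c z) v w) (snd c ` fst c)) \<and>
     (\<forall>c\<in>atlas S. \<forall>c'\<in>atlas S. \<forall>p \<in> fst c \<inter> fst c'. \<forall>v w.
        T c p v w = T c' p (chart_deriv c (snd c') p * v) (chart_deriv c (snd c') p * w))"

definition form_support :: "'a surface \<Rightarrow> 'a form \<Rightarrow> 'a set" where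
  "form_support S T =
     topo S closure_of {p \<in> points S. \<exists>c\<in>charts_at S p. \<exists>v w. T c p v w \<noteq> 0}"

definition form_add :: "'a form \<Rightarrow> 'a form \<Rightarrow> 'a form" where
  "form_add T h = (\<lambda>c p v w. T c p v w + h c p v w)"

definition riemannian_metric :: "'a surface \<Rightarrow> 'a form \<Rightarrow> bool" where
  "riemannian_metric S h \<longleftrightarrow> sym_bilinear_form S h \<and>
     (\<forall>c\<in>atlas S. \<forall>p\<in>fst c. \<forall>v. v \<noteq> 0 \<longrightarrow> h c p v v > 0)"

text \<open>The speed does not depend on the chosen chart, by the transformation law.\<close>

definition speed :: "'a surface \<Rightarrow> 'a form \<Rightarrow> (real \<Rightarrow> 'a) \<Rightarrow> real \<Rightarrow> real" where
  "speed S h \<gamma> t =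
     (let c = (SOME c. c \<in> charts_at S (\<gamma> t));
          v = vector_derivative (snd c \<circ> \<gamma>) (at t within {0..1})
      in sqrt (h c (\<gamma> t) v v))"

text \<open>The derivative of a curve in the sense above may be unbounded near the finitely many
  exceptional parameters, so the length can be infinite.\<close>

definition curve_length :: "'a surface \<Rightarrow> 'a form \<Rightarrow> (real \<Rightarrow> 'a) \<Rightarrow> ennreal" where
  "curve_length S h \<gamma> = (\<integral>\<^sup>+t\<in>{0..1}. ennreal (speed S h \<gamma> t) \<partial>lborel)"

definition riem_dist :: "'a surface \<Rightarrow> 'a form \<Rightarrow> 'a \<Rightarrow> 'a \<Rightarrow> ennreal" where
  "riem_dist S h p q = (INF \<gamma>\<in>{\<gamma>. pw_curve S \<gamma> \<and> \<gamma> 0 = p \<and> \<gamma> 1 = q}. curve_length S h \<gamma>)"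

definition complete_riemannian_metric :: "'a surface \<Rightarrow> 'a form \<Rightarrow> bool" where
  "complete_riemannian_metric S h \<longleftrightarrow> riemannian_metric S h \<and>
     (\<forall>\<sigma>::nat \<Rightarrow> 'a. range \<sigma> \<subseteq> points S \<and>
        (\<forall>e>0. \<exists>N. \<forall>m\<ge>N. \<forall>n\<ge>N. riem_dist S h (\<sigma> m) (\<sigma> n) < e) \<longrightarrow>
        (\<exists>p\<in>points S. (\<lambda>n. riem_dist S h (\<sigma> n) p) \<longlonglongrightarrow> 0))"

section \<open>Gaussian curvature and area\<close>

definition coef :: "'a form \<Rightarrow> 'a chart \<Rightarrow> complex \<Rightarrow> complex \<Rightarrow> complex \<Rightarrow> real" where
  "coef h c v w z = h c (chart_inv c z) v w"

definition partial_u :: "(complex \<Rightarrow> real) \<Rightarrow> complex \<Rightarrow> real" where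
  "partial_u f z = frechet_derivative f (at z) 1"

definition partial_v :: "(complex \<Rightarrow> real) \<Rightarrow> complex \<Rightarrow> real" where
  "partial_v f z = frechet_derivative f (at z) \<i>"

definition det3 ::
  "real \<Rightarrow> real \<Rightarrow> real \<Rightarrow> real \<Rightarrow> real \<Rightarrow> real \<Rightarrow> real \<Rightarrow> real \<Rightarrow> real \<Rightarrow> real" where
  "det3 a b c d e f g h i = a * (e * i - f * h) - b * (d * i - f * g) + c * (d * h - e * g)"

text \<open>Brioschi's formula for the Gaussian curvature of an arbitrary metric
  P du^2 + 2 Q du dv + R dv^2 in the coordinate z = u + iv.\<close>

definition brioschi ::
  "(complex \<Rightarrow> real) \<Rightarrow> (complex \<Rightarrow> real) \<Rightarrow> (complex \<Rightarrow> real) \<Rightarrow> complex \<Rightarrow> real" where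
  "brioschi P Q R z =
     (det3 (- partial_v (partial_v P) z / 2 + partial_v (partial_u Q) z
              - partial_u (partial_u R) z / 2)
           (partial_u P z / 2) (partial_u Q z - partial_v P z / 2)
           (partial_v Q z - partial_u R z / 2) (P z) (Q z)
           (partial_v R z / 2) (Q z) (R z)
      - det3 0 (partial_v P z / 2) (partial_u R z / 2)
             (partial_v P z / 2) (P z) (Q z)
             (partial_u R z / 2) (Q z) (R z))
     / (P z * R z - (Q z)\<^sup>2)\<^sup>2"

text \<open>The curvature does not depend on the chosen chart.\<close>

definition gaussian_curvature :: "'a surface \<Rightarrow> 'a form \<Rightarrow> 'a \<Rightarrow> real" where
  "gaussian_curvature S h p =
     (let c = (SOME c. c \<in> charts_at S p)
      in brioschi (coef h c 1 1) (coef h c 1 \<i>) (coef h c \<i> \<i>) (snd c p))"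

text \<open>M is the Borel measure of the area element of h.\<close>

definition area_measure :: "'a surface \<Rightarrow> 'a form \<Rightarrow> 'a measure \<Rightarrow> bool" where
  "area_measure S h M \<longleftrightarrow>
     space M = points S \<and> sets M = sigma_sets (points S) {U. openin (topo S) U} \<and>
     (\<forall>c\<in>atlas S. \<forall>A\<in>sets M. A \<subseteq> fst c \<longrightarrow>
        emeasure M A =
          (\<integral>\<^sup>+z\<in>snd c ` A. ennreal (sqrt (coef h c 1 1 z * coef h c \<i> \<i> z - (coef h c 1 \<i> z)\<^sup>2))
             \<partial>lborel))"

section \<open>Improper affine fronts\<close>

definition weierstrass_data ::
    "'a surface \<Rightarrow> ('a \<Rightarrow> complex) \<Rightarrow> ('a \<Rightarrow> complex) \<Rightarrow> bool" where
  "weierstrass_data S F G \<longleftrightarrow>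
     riemann_surface S \<and> holomorphic_fun S F \<and> holomorphic_fun S G \<and>
     (\<forall>c\<in>atlas S. \<forall>p\<in>fst c. (chart_deriv c F p, chart_deriv c G p) \<noteq> (0, 0)) \<and>
     (\<forall>\<gamma>. pw_curve S \<gamma> \<and> \<gamma> 0 = \<gamma> 1 \<longrightarrow> Re (curve_integral F G \<gamma>) = 0)"

text \<open>The indefinite integral is determined up to an additive constant: it is computed along
  curves starting at a base point, with an arbitrary constant of integration k.\<close>

definition improper_affine_front ::
    "'a surface \<Rightarrow> ('a \<Rightarrow> complex) \<Rightarrow> ('a \<Rightarrow> complex) \<Rightarrow> ('a \<Rightarrow> complex \<times> real) \<Rightarrow> bool" where
  "improper_affine_front S F G \<psi> \<longleftrightarrow> weierstrass_data S F G \<and>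
     (\<exists>p0\<in>points S. \<exists>k. \<forall>p\<in>points S. \<forall>\<gamma>. pw_curve S \<gamma> \<and> \<gamma> 0 = p0 \<and> \<gamma> 1 = p \<longrightarrow>
        \<psi> p = (G p + cnj (F p),
               ((cmod (G p))\<^sup>2 - (cmod (F p))\<^sup>2) / 2
                 + Re (G p * F p - 2 * (curve_integral F G \<gamma> + k))))"

text \<open>Polarisations of the quadratic forms |dF|^2 + |dG|^2 + dF dG + cnj (dF dG)
  and 2 (|dF|^2 + |dG|^2).\<close>

definition flat_form :: "('a \<Rightarrow> complex) \<Rightarrow> ('a \<Rightarrow> complex) \<Rightarrow> 'a form" where
  "flat_form F G = (\<lambda>c p v w.
     let dF = (\<lambda>x. chart_deriv c F p * x); dG = (\<lambda>x. chart_deriv c G p * x)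
     in Re (dF v * cnj (dF w)) + Re (dG v * cnj (dG w)) + Re (dF v * dG w + dF w * dG v))"

definition tau_form :: "('a \<Rightarrow> complex) \<Rightarrow> ('a \<Rightarrow> complex) \<Rightarrow> 'a form" where
  "tau_form F G = (\<lambda>c p v w.
     let dF = (\<lambda>x. chart_deriv c F p * x); dG = (\<lambda>x. chart_deriv c G p * x)
     in 2 * (Re (dF v * cnj (dF w)) + Re (dG v * cnj (dG w))))"

definition complete_front ::
    "'a surface \<Rightarrow> ('a \<Rightarrow> complex) \<Rightarrow> ('a \<Rightarrow> complex) \<Rightarrow> bool" where
  "complete_front S F G \<longleftrightarrow>
     (\<exists>T. sym_bilinear_form S T \<and> compactin (topo S) (form_support S T) \<and>
          complete_riemannian_metric S (form_add T (flat_form F G)))"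

definition has_total_curvature ::
    "'a surface \<Rightarrow> ('a \<Rightarrow> complex) \<Rightarrow> ('a \<Rightarrow> complex) \<Rightarrow> real \<Rightarrow> bool" where
  "has_total_curvature S F G \<kappa> \<longleftrightarrow>
     (\<exists>M. area_measure S (tau_form F G) M \<and>
          has_bochner_integral M (gaussian_curvature S (tau_form F G)) \<kappa>)"

text \<open>The equiaffine changes of Weierstrass data form a group normalised by the exchange of F and
  G, and both commute with changes of the domain. So every composition of such moves consists of
  one change of the domain and one equiaffine change, possibly followed by an exchange.\<close>

definition equivalent_data ::
    "'a surface \<Rightarrow> ('a \<Rightarrow> complex) \<Rightarrow> ('a \<Rightarrow> complex) \<Rightarrow>
     'b surface \<Rightarrow> ('b \<Rightarrow> complex) \<Rightarrow> ('b \<Rightarrow> complex) \<Rightarrow> bool" where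
  "equivalent_data S F G S' F' G' \<longleftrightarrow>
     (\<exists>f \<alpha> \<beta> \<mu> \<nu>. biholomorphism S S' f \<and> (cmod \<alpha>)\<^sup>2 - (cmod \<beta>)\<^sup>2 = 1 \<and>
        (let F1 = (\<lambda>p. \<alpha> * F p + \<beta> * G p + \<mu>);
             G1 = (\<lambda>p. cnj \<beta> * F p + cnj \<alpha> * G p + \<nu>)
         in (\<forall>p\<in>points S. F' (f p) = F1 p \<and> G' (f p) = G1 p) \<or>
            (\<forall>p\<in>points S. F' (f p) = G1 p \<and> G' (f p) = F1 p)))"

text \<open>The elliptic paraboloid, with F = 1/z and G = b/z extended by 0 to infinity.\<close>

definition paraboloid_surface :: "complex option surface" where
  "paraboloid_surface = open_subsurface riemann_sphere (- {Some 0})"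

definition paraboloid_F :: "complex option \<Rightarrow> complex" where
  "paraboloid_F p = (case p of None \<Rightarrow> 0 | Some z \<Rightarrow> 1 / z)"

definition paraboloid_G :: "complex \<Rightarrow> complex option \<Rightarrow> complex" where
  "paraboloid_G b p = (case p of None \<Rightarrow> 0 | Some z \<Rightarrow> b / z)"

end

theory Submission
  imports Defs "HOL-Complex_Analysis.Conformal_Mappings"
begin

text \<open>The metric 2(|dF|^2 + |dG|^2) has curvature - 8|W|^2 / E^3, where E is its conformal factor and
  W the Wronskian of F' and G' in a chart. As the curvature is nonpositive, total curvature 0 forces
  W = 0, so dF and dG are proportional and, after an exchange, dG = b dF with dF nowhere zero.
  Then ds^2 = |dF + cnj (b dF)|^2. If |b| = 1, it is degenerate everywhere, so the support of T is all
  of the surface, which is then compact; this is impossible for the open map F.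

  In any case T + ds^2 is at most C |dF|^2, by compactness of the support of T. So lifts along F
  of bounded segments have finite length and converge by completeness: the local inverses of F
  extend to the whole plane, and F is a biholomorphism onto the plane. Its reciprocal is the
  required change of the domain.\<close>

section \<open>Local homeomorphisms into the plane\<close>

text \<open>Completeness concerns T + ds^2, while \<open>F\<close> straightens only |dF|^2, and the
  two metrics are compared asymmetrically. The upper bound is global: it makes images of segments
  short and so produces Cauchy sequences. A lower bound holds only locally, by positive definiteness
  on compact sets; it serves to turn convergence for the Riemannian distance into convergence in the
  topology of the surface, because a short curve cannot cross a disc of fixed flat radius.

  The inverse of \<open>F\<close> is built from sections over discs, not from lifted paths. Discs
  and their intersections are convex, hence connected, so sections that agree at one point agree on
  the overlap, and the radius of a disc can be pushed to infinity. This topological part sees the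
  metric only through the existence of limits of sections along convergent sequences.

  The paraboloid's domain, the sphere without 0, is the plane seen through the global coordinate
  1/z. This is why a bijection \<open>F\<close> onto the plane gives the change of the domain at
  once.\<close>

definition local_section :: "'a topology \<Rightarrow> ('a \<Rightarrow> complex) \<Rightarrow> complex set \<Rightarrow> (complex \<Rightarrow> 'a) \<Rightarrow> bool" where
  "local_section X F U \<sigma> \<longleftrightarrow> continuous_map (top_of_set U) X \<sigma> \<and> (\<forall>u\<in>U. F (\<sigma> u) = u)"

lemma local_sectionD:
  assumes "local_section X F U \<sigma>" "u \<in> U"
  shows "F (\<sigma> u) = u" "\<sigma> u \<in> topspace X"
  using assms by (auto simp: local_section_def continuous_map_def)

lemma local_section_subset: "local_section X F U \<sigma> \<Longrightarrow> V \<subseteq> U \<Longrightarrow> local_section X F V \<sigma>"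
  unfolding local_section_def by (meson continuous_map_from_subtopology_mono subset_iff)

lemma local_section_open_preimage:
  assumes "local_section X F U \<sigma>" "open U" "openin X N"
  shows "open {u \<in> U. \<sigma> u \<in> N}"
proof -
  have "openin (top_of_set U) {u \<in> topspace (top_of_set U). \<sigma> u \<in> N}"
    using assms openin_continuous_map_preimage unfolding local_section_def by blast
  then show ?thesis
    using \<open>open U\<close> by (simp add: openin_open_eq)
qed

text \<open>Openness and local injectivity are what the inverse function theorem supplies.
  Hausdorffness makes the coincidence set of two continuous maps closed, which uniqueness of
  sections rests on.\<close>

locale local_homeomorphism =
  fixes X :: "'a topology" and F :: "'a \<Rightarrow> complex"
  assumes Hausdorff: "Hausdorff_space X"
    and cont: "continuous_map X euclidean F"
    and open_image: "openin X W \<Longrightarrow> open (F ` W)"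
    and locally_inj: "p \<in> topspace X \<Longrightarrow> \<exists>N. openin X N \<and> p \<in> N \<and> inj_on F N"
begin

abbreviation sect :: "complex set \<Rightarrow> (complex \<Rightarrow> 'a) \<Rightarrow> bool" where
  "sect \<equiv> local_section X F"

lemma open_preimage: "open V \<Longrightarrow> openin X {p \<in> topspace X. F p \<in> V}"
  using openin_continuous_map_preimage[OF cont] by auto

text \<open>Near \<open>\<sigma> u\<close> the map \<open>F\<close> is injective. A point x near
  \<open>\<sigma> u\<close> and the point \<open>\<sigma> (F x)\<close> have the same image under
  \<open>F\<close>, so they coincide, and x lies in the image of the section.\<close>

lemma section_open_image:
  assumes "sect U \<sigma>" "open U"
  shows "openin X (\<sigma> ` U)"
proof (subst openin_subopen, clarify)
  fix u assume u: "u \<in> U"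
  obtain N where N: "openin X N" "\<sigma> u \<in> N" "inj_on F N"
    using locally_inj local_sectionD[OF assms(1) u] by blast
  define V where "V = {v \<in> U. \<sigma> v \<in> N}"
  have "open V"
    unfolding V_def using local_section_open_preimage assms N(1) by blast
  let ?W = "N \<inter> {p \<in> topspace X. F p \<in> V}"
  have "openin X ?W"
    using N(1) open_preimage[OF \<open>open V\<close>] by blast
  moreover have "\<sigma> u \<in> ?W"
    using N u local_sectionD[OF assms(1) u] by (simp add: V_def)
  moreover have "?W \<subseteq> \<sigma> ` U"
  proof
    fix x assume x: "x \<in> ?W"
    then have "F x \<in> U" "\<sigma> (F x) \<in> N" by (auto simp: V_def)
    then have "x = \<sigma> (F x)"
      using N(3) x local_sectionD(1)[OF assms(1) \<open>F x \<in> U\<close>] by (metis IntD1 inj_onD)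
    then show "x \<in> \<sigma> ` U" using \<open>F x \<in> U\<close> by blast
  qed
  ultimately show "\<exists>T. openin X T \<and> \<sigma> u \<in> T \<and> T \<subseteq> \<sigma> ` U" by blast
qed

text \<open>The coincidence set is closed because the space is Hausdorff, and open because
  \<open>F\<close> is injective near a common value of both sections.\<close>

lemma section_unique:
  assumes s: "sect U \<sigma>" and t: "sect U \<tau>" and U: "open U" "connected U"
    and u0: "u0 \<in> U" "\<sigma> u0 = \<tau> u0" and u: "u \<in> U"
  shows "\<sigma> u = \<tau> u"
proof -
  let ?E = "{u \<in> U. \<sigma> u = \<tau> u}"
  have "closedin (top_of_set U) {u \<in> topspace (top_of_set U). \<sigma> u = \<tau> u}"
    using s t closedin_continuous_maps_eq[OF Hausdorff] unfolding local_section_def by blast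
  moreover have "open ?E"
  proof (subst open_subopen, clarify)
    fix v assume v: "v \<in> U" "\<sigma> v = \<tau> v"
    obtain N where N: "openin X N" "\<sigma> v \<in> N" "inj_on F N"
      using locally_inj local_sectionD[OF s v(1)] by blast
    let ?T = "{u \<in> U. \<sigma> u \<in> N} \<inter> {u \<in> U. \<tau> u \<in> N}"
    have "open ?T"
      using local_section_open_preimage s t U N(1) by blast
    moreover have "v \<in> ?T" using v N by auto
    moreover have "?T \<subseteq> ?E"
      using N(3) local_sectionD[OF s] local_sectionD[OF t] by (auto simp: inj_on_def)
    ultimately show "\<exists>T. open T \<and> v \<in> T \<and> T \<subseteq> ?E" by blast
  qed
  ultimately have "?E = {} \<or> ?E = U"
    using U(2) unfolding connected_clopen by (auto simp: openin_open_eq U(1))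
  then show ?thesis using u0 u by blast
qed

text \<open>The section is the inverse of \<open>F\<close> on a neighbourhood where \<open>F\<close>
  is injective and open. Shrinking this neighbourhood into \<open>A\<close> allows the image to be
  kept inside a chart or a given neighbourhood.\<close>

lemma local_section_exists:
  assumes p: "p \<in> topspace X" and A: "openin X A" "p \<in> A"
  shows "\<exists>r>0. \<exists>\<sigma>. sect (ball (F p) r) \<sigma> \<and> \<sigma> (F p) = p \<and> \<sigma> ` ball (F p) r \<subseteq> A"
proof -
  obtain N0 where N0: "openin X N0" "p \<in> N0" "inj_on F N0"
    using locally_inj p by blast
  define N where "N = N0 \<inter> A"
  have N: "openin X N" "p \<in> N" "inj_on F N"
    using N0 A by (auto simp: N_def inj_on_def)
  have oN: "open (F ` N)" using open_image N(1) .
  obtain r where r: "r > 0" "ball (F p) r \<subseteq> F ` N"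
    using openE[OF oN imageI[OF N(2)]] .
  let ?\<sigma> = "inv_into N F"
  have "continuous_map (top_of_set (F ` N)) X ?\<sigma>"
    unfolding continuous_map_def
  proof (intro conjI allI impI)
    show "?\<sigma> \<in> topspace (top_of_set (F ` N)) \<rightarrow> topspace X"
    proof
      fix u assume "u \<in> topspace (top_of_set (F ` N))"
      then have "?\<sigma> u \<in> N" using inv_into_into[of u F N] by simp
      then show "?\<sigma> u \<in> topspace X" using openin_subset[OF N(1)] by blast
    qed
    fix W assume "openin X W"
    have "{x \<in> topspace (top_of_set (F ` N)). ?\<sigma> x \<in> W} = F ` (N \<inter> W)"
      using inv_into_f_f[OF N(3)] by auto
    moreover have "open (F ` (N \<inter> W))"
      using open_image openin_Int[OF N(1) \<open>openin X W\<close>] .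
    ultimately show "openin (top_of_set (F ` N)) {x \<in> topspace (top_of_set (F ` N)). ?\<sigma> x \<in> W}"
      by (simp add: open_subset image_mono)
  qed
  then have "sect (F ` N) ?\<sigma>"
    by (auto simp: local_section_def f_inv_into_f)
  then have "sect (ball (F p) r) ?\<sigma>"
    using local_section_subset r by blast
  moreover have "?\<sigma> (F p) = p" using N by simp
  moreover have "?\<sigma> ` ball (F p) r \<subseteq> A"
  proof
    fix x assume "x \<in> ?\<sigma> ` ball (F p) r"
    then have "x \<in> N" using r(2) inv_into_into[of _ F N] by blast
    then show "x \<in> A" by (simp add: N_def)
  qed
  ultimately show ?thesis using r by blast
qed

text \<open>The choice of an index for each point is harmless because the sections agree on
  overlaps.\<close>

lemma section_glue:
  assumes s: "\<And>i. i \<in> I \<Longrightarrow> sect (U i) (\<sigma> i)" and U: "\<And>i. i \<in> I \<Longrightarrow> open (U i)"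
    and agree: "\<And>i j u. i \<in> I \<Longrightarrow> j \<in> I \<Longrightarrow> u \<in> U i \<Longrightarrow> u \<in> U j \<Longrightarrow> \<sigma> i u = \<sigma> j u"
  obtains \<tau> where "sect (\<Union>i\<in>I. U i) \<tau>" "\<And>i u. i \<in> I \<Longrightarrow> u \<in> U i \<Longrightarrow> \<tau> u = \<sigma> i u"
proof -
  let ?V = "\<Union>i\<in>I. U i"
  define \<tau> where "\<tau> u = \<sigma> (SOME i. i \<in> I \<and> u \<in> U i) u" for u
  have \<tau>: "\<tau> u = \<sigma> i u" if "i \<in> I" "u \<in> U i" for i u
    unfolding \<tau>_def using someI[of "\<lambda>i. i \<in> I \<and> u \<in> U i" i] that agree by blast
  have "continuous_map (top_of_set ?V) X \<tau>"
    unfolding continuous_map_def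
  proof (intro conjI allI impI)
    show "\<tau> \<in> topspace (top_of_set ?V) \<rightarrow> topspace X"
      using \<tau> local_sectionD(2)[OF s] by auto
    fix W assume W: "openin X W"
    have "{x \<in> topspace (top_of_set ?V). \<tau> x \<in> W} = (\<Union>i\<in>I. {u \<in> U i. \<sigma> i u \<in> W})"
      using \<tau> by auto
    moreover have "open \<dots>"
      using local_section_open_preimage[OF s U W] by blast
    ultimately show "openin (top_of_set ?V) {x \<in> topspace (top_of_set ?V). \<tau> x \<in> W}"
      by (auto intro: open_subset)
  qed
  then have "sect ?V \<tau>"
    using \<tau> local_sectionD(1)[OF s] by (auto simp: local_section_def)
  then show thesis using that \<tau> by blast
qed

text \<open>The extensions over discs of the common radius \<open>\<epsilon>\<close> are glued. If
  two such discs meet, their centres are less than \<open>2 * \<epsilon>\<close> apart, so the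
  midpoint of the centres lies in both discs and, by convexity, in \<open>ball z R\<close>. There
  both extensions agree with \<open>\<sigma>\<close>, hence with each other on the whole
  overlap.\<close>

lemma section_extend:
  assumes s: "sect (ball z R) \<sigma>" and R: "R > 0" and \<epsilon>: "\<epsilon> > 0"
    and ext: "\<And>u. u \<in> ball z R \<Longrightarrow> \<exists>\<tau>. sect (ball u \<epsilon>) \<tau> \<and> \<tau> u = \<sigma> u"
  shows "\<exists>\<sigma>'. sect (ball z (R + \<epsilon>)) \<sigma>' \<and> (\<forall>u\<in>ball z R. \<sigma>' u = \<sigma> u)"
proof -
  obtain \<tau> where \<tau>: "\<And>u. u \<in> ball z R \<Longrightarrow> sect (ball u \<epsilon>) (\<tau> u) \<and> \<tau> u u = \<sigma> u"
    using ext by metis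
  have eq: "\<tau> u v = \<sigma> v" if "u \<in> ball z R" "v \<in> ball z R" "v \<in> ball u \<epsilon>" for u v
  proof (rule section_unique[of "ball z R \<inter> ball u \<epsilon>" _ _ u])
    show "sect (ball z R \<inter> ball u \<epsilon>) (\<tau> u)" "sect (ball z R \<inter> ball u \<epsilon>) \<sigma>"
      using local_section_subset \<tau>[OF that(1)] s by (meson inf_le1 inf_le2)+
    show "connected (ball z R \<inter> ball u \<epsilon>)"
      by (simp add: convex_Int convex_connected)
  qed (use that \<tau> \<epsilon> in auto)
  obtain \<sigma>' where \<sigma>': "sect (\<Union>u\<in>ball z R. ball u \<epsilon>) \<sigma>'"
    "\<And>u v. u \<in> ball z R \<Longrightarrow> v \<in> ball u \<epsilon> \<Longrightarrow> \<sigma>' v = \<tau> u v"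
  proof (rule section_glue[of "ball z R" "\<lambda>u. ball u \<epsilon>" \<tau>])
    fix u v w assume *: "u \<in> ball z R" "v \<in> ball z R" "w \<in> ball u \<epsilon>" "w \<in> ball v \<epsilon>"
    let ?m = "midpoint u v"
    have m: "?m \<in> ball z R"
      using * by (meson convex_ball convex_contains_segment midpoint_in_closed_segment subsetD)
    have "dist u v < 2 * \<epsilon>"
      using * by (smt (verit) dist_commute dist_triangle mem_ball)
    then have m2: "?m \<in> ball u \<epsilon>" "?m \<in> ball v \<epsilon>"
      by (simp_all add: dist_midpoint)
    show "\<tau> u w = \<tau> v w"
    proof (rule section_unique[of "ball u \<epsilon> \<inter> ball v \<epsilon>" _ _ ?m])
      show "sect (ball u \<epsilon> \<inter> ball v \<epsilon>) (\<tau> u)" "sect (ball u \<epsilon> \<inter> ball v \<epsilon>) (\<tau> v)"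
        using local_section_subset \<tau> * by (meson inf_le1 inf_le2)+
      show "connected (ball u \<epsilon> \<inter> ball v \<epsilon>)"
        by (simp add: convex_Int convex_connected)
      show "\<tau> u ?m = \<tau> v ?m"
        using eq m m2 * by metis
    qed (use * m2 in auto)
  qed (use \<tau> in auto)
  have sub: "ball z (R + \<epsilon>) \<subseteq> (\<Union>u\<in>ball z R. ball u \<epsilon>)"
  proof
    fix w assume "w \<in> ball z (R + \<epsilon>)"
    then have d: "cmod (w - z) < R + \<epsilon>" by (simp add: dist_norm norm_minus_commute)
    \<comment> \<open>The point at the fraction R / (R + \<epsilon>) of the way from
      \<open>z\<close> to \<open>w\<close> is within \<open>R\<close> of \<open>z\<close> and within
      \<epsilon> of \<open>w\<close>.\<close>
    define l where "l = R / (R + \<epsilon>)"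
    have l: "0 < l" "l * (R + \<epsilon>) = R" "(1 - l) * (R + \<epsilon>) = \<epsilon>" "0 < 1 - l"
      using R \<epsilon> by (auto simp: l_def field_simps)
    define u where "u = z + of_real l * (w - z)"
    have "dist z u = l * cmod (w - z)"
      using l(1) by (simp add: u_def dist_norm norm_mult)
    also have "\<dots> < R" using d l by (metis mult_strict_left_mono)
    finally have 1: "u \<in> ball z R" by simp
    have "w - u = of_real (1 - l) * (w - z)"
      by (simp add: u_def algebra_simps)
    then have "dist u w = (1 - l) * cmod (w - z)"
      using l(4) by (metis abs_of_pos dist_commute dist_norm norm_mult norm_of_real)
    also have "\<dots> < \<epsilon>" using d l by (metis mult_strict_left_mono)
    finally have "w \<in> ball u \<epsilon>" by simp
    then show "w \<in> (\<Union>u\<in>ball z R. ball u \<epsilon>)" using 1 by blast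
  qed
  have "\<sigma>' u = \<sigma> u" if "u \<in> ball z R" for u
    using \<sigma>'(2)[OF that, of u] \<epsilon> \<tau>[OF that] by simp
  then show ?thesis
    using \<sigma>'(1) sub local_section_subset by blast
qed

end

text \<open>The limit condition holds when the flat metric pulled back along F is complete.\<close>

locale complete_local_homeomorphism = local_homeomorphism +
  assumes connected: "connected_space X"
    and section_limit: "\<lbrakk>sect (ball z R) \<sigma>; \<And>n. u n \<in> ball z R; u \<longlonglongrightarrow> w\<rbrakk> \<Longrightarrow>
      \<exists>q. limitin X (\<lambda>n. \<sigma> (u n)) q sequentially"
begin

text \<open>A sequence in the disc tending to \<open>w\<close> has images tending to some q, and
  continuity forces \<open>F q = w\<close>. The section through q has an open image, which therefore
  contains some \<open>\<sigma> (u n)\<close>. It agrees with \<open>\<sigma>\<close> at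
  \<open>u n\<close>, and so on the whole intersection of the two discs.\<close>

lemma section_extend_boundary:
  assumes s: "sect (ball z R) \<sigma>" and R: "R > 0" and w: "w \<in> cball z R"
  shows "\<exists>r>0. \<exists>\<tau>. sect (ball w r) \<tau> \<and> (\<forall>u\<in>ball z R \<inter> ball w r. \<tau> u = \<sigma> u)"
proof -
  have "w \<in> closure (ball z R)" using w R by simp
  then obtain u :: "nat \<Rightarrow> complex" where uR: "\<And>n. u n \<in> ball z R" and ulim: "u \<longlonglongrightarrow> w"
    unfolding closure_sequential by blast
  obtain q where q: "limitin X (\<lambda>n. \<sigma> (u n)) q sequentially"
    using section_limit[OF s uR ulim] by blast
  have "limitin euclidean (F \<circ> (\<lambda>n. \<sigma> (u n))) (F q) sequentially"
    by (rule continuous_map_limit[OF cont q])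
  then have "(\<lambda>n. F (\<sigma> (u n))) \<longlonglongrightarrow> F q" by (simp add: o_def)
  moreover have "F (\<sigma> (u n)) = u n" for n
    using local_sectionD(1)[OF s uR] .
  ultimately have Fq: "F q = w" using ulim LIMSEQ_unique by auto
  have qX: "q \<in> topspace X" using q by (simp add: limitin_def)
  obtain r \<tau> where r: "r > 0" and \<tau>: "sect (ball w r) \<tau>" "\<tau> w = q"
    using local_section_exists[OF qX openin_topspace qX] unfolding Fq by blast
  have "openin X (\<tau> ` ball w r)" using section_open_image \<tau>(1) by simp
  moreover have "q \<in> \<tau> ` ball w r" using \<tau>(2) r by force
  ultimately have "\<forall>\<^sub>F n in sequentially. \<sigma> (u n) \<in> \<tau> ` ball w r"
    using q by (simp add: limitin_def)
  then obtain n where "\<sigma> (u n) \<in> \<tau> ` ball w r"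
    unfolding eventually_sequentially by blast
  then obtain v where v: "v \<in> ball w r" "\<sigma> (u n) = \<tau> v" by blast
  then have "v = u n"
    using local_sectionD(1)[OF \<tau>(1) v(1)] local_sectionD(1)[OF s uR] by metis
  have "\<tau> x = \<sigma> x" if "x \<in> ball z R \<inter> ball w r" for x
  proof (rule section_unique[of "ball z R \<inter> ball w r" _ _ "u n"])
    show "sect (ball z R \<inter> ball w r) \<tau>" "sect (ball z R \<inter> ball w r) \<sigma>"
      using local_section_subset \<tau>(1) s by (meson inf_le1 inf_le2)+
    show "connected (ball z R \<inter> ball w r)"
      by (simp add: convex_Int convex_connected)
  qed (use that v \<open>v = u n\<close> uR in auto)
  then show ?thesis using r \<tau>(1) by blast
qed

text \<open>Compactness of the closed disc gives a Lebesgue number for the cover by the discs of the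
  boundary extensions. It is the uniform radius with which the section can be enlarged.\<close>

lemma section_extend_strictly:
  assumes s: "sect (ball z R) \<sigma>" and R: "R > 0"
  shows "\<exists>R'>R. \<exists>\<sigma>'. sect (ball z R') \<sigma>' \<and> \<sigma>' z = \<sigma> z"
proof -
  obtain r \<tau> where r: "\<And>w. w \<in> cball z R \<Longrightarrow> r w > 0"
    and \<tau>: "\<And>w. w \<in> cball z R \<Longrightarrow> sect (ball w (r w)) (\<tau> w)"
      "\<And>w u. w \<in> cball z R \<Longrightarrow> u \<in> ball z R \<inter> ball w (r w) \<Longrightarrow> \<tau> w u = \<sigma> u"
    using section_extend_boundary[OF s R] by metis
  have "cball z R \<subseteq> (\<Union>w\<in>cball z R. ball w (r w))"
    using r by force
  then obtain \<epsilon> where \<epsilon>: "\<epsilon> > 0"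
    "\<And>u. u \<in> cball z R \<Longrightarrow> \<exists>G\<in>(\<lambda>w. ball w (r w)) ` cball z R. ball u \<epsilon> \<subseteq> G"
    using Heine_Borel_lemma[OF compact_cball, of z R "(\<lambda>w. ball w (r w)) ` cball z R"]
    by (metis (no_types, lifting) imageE open_ball)
  have "\<exists>\<tau>'. sect (ball u \<epsilon>) \<tau>' \<and> \<tau>' u = \<sigma> u" if u: "u \<in> ball z R" for u
  proof -
    obtain w where w: "w \<in> cball z R" "ball u \<epsilon> \<subseteq> ball w (r w)"
      using \<epsilon>(2)[of u] u by auto
    have "u \<in> ball w (r w)" using w(2) \<epsilon>(1) by (meson centre_in_ball subsetD)
    then have "\<tau> w u = \<sigma> u" using \<tau>(2)[OF w(1)] u by blast
    then show ?thesis using local_section_subset \<tau>(1)[OF w(1)] w(2) by blast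
  qed
  from section_extend[OF s R \<epsilon>(1) this] show ?thesis
    using R \<epsilon>(1) by (metis centre_in_ball less_add_same_cancel1)
qed

text \<open>Sections over concentric discs with the same value at the centre agree, so they glue. If
  the radii were bounded, the glued section would be defined over the disc of the supremal radius
  and would extend beyond it.\<close>

lemma section_global:
  assumes p: "p \<in> topspace X"
  obtains \<sigma> where "sect UNIV \<sigma>" "\<sigma> (F p) = p"
proof -
  let ?z = "F p"
  define Rs where "Rs = {R. R > 0 \<and> (\<exists>\<sigma>. sect (ball ?z R) \<sigma> \<and> \<sigma> ?z = p)}"
  obtain \<sigma> where \<sigma>: "\<And>R. R \<in> Rs \<Longrightarrow> sect (ball ?z R) (\<sigma> R) \<and> \<sigma> R ?z = p"
    using bchoice[of Rs "\<lambda>R \<sigma>. sect (ball ?z R) \<sigma> \<and> \<sigma> ?z = p"] unfolding Rs_def by blast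
  obtain r0 where r0: "r0 \<in> Rs"
    unfolding Rs_def using local_section_exists[OF p openin_topspace p] by blast
  have agree: "\<sigma> R u = \<sigma> R' u" if "R \<in> Rs" "R' \<in> Rs" "u \<in> ball ?z R" "u \<in> ball ?z R'" for R R' u
  proof (rule section_unique[of "ball ?z R \<inter> ball ?z R'" _ _ ?z])
    show "sect (ball ?z R \<inter> ball ?z R') (\<sigma> R)" "sect (ball ?z R \<inter> ball ?z R') (\<sigma> R')"
      using local_section_subset \<sigma> that by (meson inf_le1 inf_le2)+
    show "connected (ball ?z R \<inter> ball ?z R')"
      by (simp add: convex_Int convex_connected)
  qed (use that \<sigma> Rs_def in auto)
  obtain \<tau> where \<tau>: "sect (\<Union>R\<in>Rs. ball ?z R) \<tau>"
    "\<And>R u. R \<in> Rs \<Longrightarrow> u \<in> ball ?z R \<Longrightarrow> \<tau> u = \<sigma> R u"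
    using section_glue[of Rs "\<lambda>R. ball ?z R" \<sigma>] \<sigma> agree by (metis open_ball)
  have \<tau>z: "\<tau> ?z = p"
    using \<tau>(2)[OF r0, of ?z] r0 \<sigma> by (simp add: Rs_def)
  have "\<not> bdd_above Rs"
  proof
    assume bdd: "bdd_above Rs"
    have pos: "Sup Rs > 0"
      using r0 cSup_upper[OF r0 bdd] by (simp add: Rs_def)
    have "ball ?z (Sup Rs) \<subseteq> (\<Union>R\<in>Rs. ball ?z R)"
      using less_cSup_iff[OF _ bdd] r0 by fastforce
    then have "sect (ball ?z (Sup Rs)) \<tau>"
      using \<tau>(1) local_section_subset by blast
    then obtain R' \<sigma>' where "R' > Sup Rs" "sect (ball ?z R') \<sigma>'" "\<sigma>' ?z = p"
      using section_extend_strictly pos \<tau>z by metis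
    then have "R' \<in> Rs" using pos by (auto simp: Rs_def)
    then show False using cSup_upper[OF _ bdd] \<open>R' > Sup Rs\<close> by fastforce
  qed
  then have "(\<Union>R\<in>Rs. ball ?z R) = UNIV"
    unfolding bdd_above_def by (force simp: not_le)
  then show thesis using that \<tau>(1) \<tau>z by simp
qed

text \<open>The image of a global section is open, and it is closed as the coincidence set of
  \<open>\<sigma> \<circ> F\<close> and the identity. By connectedness it is the whole space, so
  \<open>\<sigma>\<close> is also a left inverse.\<close>

lemma section_inverse:
  assumes "topspace X \<noteq> {}"
  obtains \<sigma> where "sect UNIV \<sigma>" "\<And>p. p \<in> topspace X \<Longrightarrow> \<sigma> (F p) = p"
proof -
  obtain p0 where p0: "p0 \<in> topspace X" using assms by blast
  obtain \<sigma> where \<sigma>: "sect UNIV \<sigma>" "\<sigma> (F p0) = p0"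
    using section_global[OF p0] .
  have c1: "continuous_map X X (\<sigma> \<circ> F)"
    using \<sigma>(1) cont unfolding local_section_def by (auto intro: continuous_map_compose)
  have "closedin X {p \<in> topspace X. (\<sigma> \<circ> F) p = id p}"
    by (rule closedin_continuous_maps_eq[OF Hausdorff c1]) simp
  moreover have "{p \<in> topspace X. (\<sigma> \<circ> F) p = id p} = range \<sigma>"
  proof (intro equalityI subsetI)
    fix p assume "p \<in> {p \<in> topspace X. (\<sigma> \<circ> F) p = id p}"
    then show "p \<in> range \<sigma>" by (metis (mono_tags) comp_apply id_apply mem_Collect_eq rangeI)
  next
    fix p assume "p \<in> range \<sigma>"
    then show "p \<in> {p \<in> topspace X. (\<sigma> \<circ> F) p = id p}"
      using local_sectionD[OF \<sigma>(1) UNIV_I] by auto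
  qed
  moreover have "openin X (range \<sigma>)"
    using section_open_image \<sigma>(1) by simp
  ultimately have "range \<sigma> = topspace X"
    using connected unfolding connected_space_clopen_in by (metis rangeI empty_iff)
  then have "\<sigma> (F p) = p" if "p \<in> topspace X" for p
    using that local_sectionD(1)[OF \<sigma>(1) UNIV_I] by (metis imageE)
  then show thesis
    using that \<sigma>(1) by blast
qed

end

section \<open>Charts and holomorphic functions\<close>

locale connected_riemann_surface =
  fixes S :: "'a surface"
  assumes RS: "riemann_surface S"
begin

lemma
  shows points_nonempty: "points S \<noteq> {}"
    and Hausdorff_S: "Hausdorff_space (topo S)"
    and connected_S: "connected_space (topo S)"
    and charts_cover: "(\<Union>c\<in>atlas S. fst c) = points S"
  using RS unfolding riemann_surface_def by auto

lemma
  assumes "c \<in> atlas S"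
  shows chart_open: "openin (topo S) (fst c)"
    and chart_image_open: "open (snd c ` fst c)"
    and chart_homeo: "homeomorphic_map (subtopology (topo S) (fst c)) (top_of_set (snd c ` fst c)) (snd c)"
    and transition_holomorphic:
      "c' \<in> atlas S \<Longrightarrow> (snd c' \<circ> chart_inv c) holomorphic_on snd c ` (fst c \<inter> fst c')"
  using RS assms unfolding riemann_surface_def by auto

lemma chart_subset: "c \<in> atlas S \<Longrightarrow> fst c \<subseteq> points S"
  using openin_subset[OF chart_open] .

lemma charts_at_nonempty: "p \<in> points S \<Longrightarrow> \<exists>c. c \<in> charts_at S p"
  using charts_cover unfolding charts_at_def by blast

lemma charts_atD: "c \<in> charts_at S p \<Longrightarrow> c \<in> atlas S" "c \<in> charts_at S p \<Longrightarrow> p \<in> fst c"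
  unfolding charts_at_def by auto

lemma topspace_chart: "c \<in> atlas S \<Longrightarrow> topspace (subtopology (topo S) (fst c)) = fst c"
  by (simp add: Int_absorb1 chart_subset)

lemma chart_inj: "c \<in> atlas S \<Longrightarrow> inj_on (snd c) (fst c)"
  using homeomorphic_imp_injective_map[OF chart_homeo] topspace_chart by metis

lemma chart_inv_left: "c \<in> atlas S \<Longrightarrow> p \<in> fst c \<Longrightarrow> chart_inv c (snd c p) = p"
  unfolding chart_inv_def using chart_inj inv_into_f_f by metis

lemma
  assumes "c \<in> atlas S" "z \<in> snd c ` fst c"
  shows chart_inv_right: "snd c (chart_inv c z) = z"
    and chart_inv_in: "chart_inv c z \<in> fst c"
  using assms by (auto simp: chart_inv_left)

lemma chart_continuous: "c \<in> atlas S \<Longrightarrow> continuous_map (subtopology (topo S) (fst c)) euclidean (snd c)"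
  using homeomorphic_imp_continuous_map[OF chart_homeo] continuous_map_in_subtopology by blast

lemma chart_image_open_subset:
  assumes c: "c \<in> atlas S" and U: "openin (topo S) U" "U \<subseteq> fst c"
  shows "open (snd c ` U)"
proof -
  have "openin (subtopology (topo S) (fst c)) U"
    using U chart_open[OF c] by (simp add: openin_open_subtopology)
  then have "openin (top_of_set (snd c ` fst c)) (snd c ` U)"
    using homeomorphic_imp_open_map[OF chart_homeo[OF c]] unfolding open_map_def by blast
  then show ?thesis
    using openin_open_trans chart_image_open[OF c] by blast
qed

lemma chart_preimage_open:
  assumes c: "c \<in> atlas S" and V: "open V"
  shows "openin (topo S) {p \<in> fst c. snd c p \<in> V}"
proof -
  have "openin (subtopology (topo S) (fst c)) {p \<in> topspace (subtopology (topo S) (fst c)). snd c p \<in> V}"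
    using openin_continuous_map_preimage[OF chart_continuous[OF c]] V by simp
  then have "openin (subtopology (topo S) (fst c)) {p \<in> fst c. snd c p \<in> V}"
    by (simp only: topspace_chart[OF c])
  then show ?thesis
    using chart_open[OF c] openin_trans_full by blast
qed

lemma overlap_image_open:
  assumes "c \<in> atlas S" "c' \<in> atlas S"
  shows "open (snd c ` (fst c \<inter> fst c'))"
  using chart_image_open_subset[of c "fst c \<inter> fst c'"] chart_open assms by blast

lemma transition_has_derivative:
  assumes c: "c \<in> atlas S" "c' \<in> atlas S" and p: "p \<in> fst c" "p \<in> fst c'"
  shows "((snd c' \<circ> chart_inv c) has_field_derivative chart_deriv c (snd c') p) (at (snd c p))"
  unfolding chart_deriv_def
  using holomorphic_derivI[OF transition_holomorphic[OF c] overlap_image_open[OF c]] p by blast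

lemma holomorphic_has_chart_deriv:
  assumes "holomorphic_fun S f" "c \<in> atlas S" "p \<in> fst c"
  shows "((f \<circ> chart_inv c) has_field_derivative chart_deriv c f p) (at (snd c p))"
  unfolding chart_deriv_def
  using holomorphic_derivI[of "f \<circ> chart_inv c"] chart_image_open assms
  unfolding holomorphic_fun_def by blast

lemma chart_change_eq:
  assumes c: "c \<in> atlas S" "c' \<in> atlas S" and z: "z \<in> snd c ` (fst c \<inter> fst c')"
  shows "(f \<circ> chart_inv c) z = ((f \<circ> chart_inv c') \<circ> (snd c' \<circ> chart_inv c)) z"
  using z chart_inv_left[OF c(1)] chart_inv_left[OF c(2)] by auto

lemma has_derivative_chart_change:
  assumes c: "c \<in> atlas S" "c' \<in> atlas S" and p: "p \<in> fst c" "p \<in> fst c'"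
    and f: "((f \<circ> chart_inv c') has_field_derivative D) (at (snd c' p))"
  shows "((f \<circ> chart_inv c) has_field_derivative D * chart_deriv c (snd c') p) (at (snd c p))"
proof (rule has_field_derivative_transform_within_open)
  have "((f \<circ> chart_inv c') has_field_derivative D) (at ((snd c' \<circ> chart_inv c) (snd c p)))"
    using f chart_inv_left[OF c(1) p(1)] by simp
  from DERIV_chain[OF this transition_has_derivative[OF c p]]
  show "((f \<circ> chart_inv c') \<circ> (snd c' \<circ> chart_inv c) has_field_derivative
      D * chart_deriv c (snd c') p) (at (snd c p))" .
  show "open (snd c ` (fst c \<inter> fst c'))" using overlap_image_open[OF c] .
qed (use chart_change_eq[OF c, of _ f] p in auto)

lemma chart_deriv_change:
  assumes "holomorphic_fun S f" and c: "c \<in> atlas S" "c' \<in> atlas S" and p: "p \<in> fst c" "p \<in> fst c'"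
  shows "chart_deriv c f p = chart_deriv c' f p * chart_deriv c (snd c') p"
  using has_derivative_chart_change[OF c p holomorphic_has_chart_deriv[OF assms(1) c(2) p(2)]]
  unfolding chart_deriv_def[of c f] by (rule DERIV_imp_deriv)

text \<open>By the chain rule, the derivatives of a transition map and of its inverse multiply to
  1.\<close>

lemma transition_deriv_nonzero:
  assumes c: "c \<in> atlas S" "c' \<in> atlas S" and p: "p \<in> fst c" "p \<in> fst c'"
  shows "chart_deriv c (snd c') p \<noteq> 0"
proof -
  have 1: "((snd c \<circ> chart_inv c) has_field_derivative
      chart_deriv c' (snd c) p * chart_deriv c (snd c') p) (at (snd c p))"
    by (rule has_derivative_chart_change[OF c p transition_has_derivative[OF c(2,1) p(2,1)]])
  have "((snd c \<circ> chart_inv c) has_field_derivative 1) (at (snd c p))"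
    by (rule has_field_derivative_transform_within_open[OF DERIV_ident chart_image_open[OF c(1)]])
      (use p chart_inv_left[OF c(1)] in auto)
  with 1 have "chart_deriv c' (snd c) p * chart_deriv c (snd c') p = 1"
    by (rule DERIV_unique)
  then show ?thesis by auto
qed

lemma holomorphic_fun_continuous:
  assumes f: "holomorphic_fun S f"
  shows "continuous_map (topo S) euclidean f"
  unfolding continuous_map_def
proof (intro conjI allI impI)
  fix V :: "complex set" assume "openin euclidean V"
  then have V: "open V" by simp
  have "\<exists>T. openin (topo S) T \<and> p \<in> T \<and> T \<subseteq> {p \<in> points S. f p \<in> V}"
    if p: "p \<in> points S" "f p \<in> V" for p
  proof -
    obtain c where c: "c \<in> atlas S" "p \<in> fst c" using charts_cover p by blast
    have "continuous_on (snd c ` fst c) (f \<circ> chart_inv c)"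
      using f c(1) holomorphic_on_imp_continuous_on unfolding holomorphic_fun_def by blast
    then have o: "open (snd c ` fst c \<inter> (f \<circ> chart_inv c) -` V)"
      using continuous_open_preimage chart_image_open[OF c(1)] V by blast
    let ?N = "{p \<in> fst c. snd c p \<in> snd c ` fst c \<inter> (f \<circ> chart_inv c) -` V}"
    have "p \<in> ?N" using c p chart_inv_left[OF c(1)] by simp
    moreover have "?N \<subseteq> {p \<in> points S. f p \<in> V}"
    proof
      fix x assume x: "x \<in> ?N"
      then have "f (chart_inv c (snd c x)) \<in> V" by simp
      then show "x \<in> {p \<in> points S. f p \<in> V}"
        using x chart_inv_left[OF c(1), of x] chart_subset[OF c(1)] by auto
    qed
    ultimately show ?thesis using chart_preimage_open[OF c(1) o] by blast
  qed
  then show "openin (topo S) {p \<in> points S. f p \<in> V}"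
    by (subst openin_subopen) blast
qed simp

text \<open>The inverse function theorem is applied in a chart inside an arbitrary open
  \<open>W\<close>. Letting \<open>W\<close> vary gives openness of the map, and taking
  \<open>W\<close> to be the whole space gives local injectivity.\<close>

lemma holomorphic_fun_local_homeomorphism:
  assumes f: "holomorphic_fun S f"
    and nz: "\<And>c p. c \<in> atlas S \<Longrightarrow> p \<in> fst c \<Longrightarrow> chart_deriv c f p \<noteq> 0"
  shows "local_homeomorphism (topo S) f"
proof
  have inv: "\<exists>N \<subseteq> W. openin (topo S) N \<and> p \<in> N \<and> inj_on f N \<and> open (f ` N)"
    if W: "openin (topo S) W" "p \<in> W" for W p
  proof -
    obtain c where c: "c \<in> atlas S" "p \<in> fst c"
      using charts_cover openin_subset[OF W(1)] W(2) by blast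
    define A where "A = snd c ` (W \<inter> fst c)"
    have "f \<circ> chart_inv c holomorphic_on A"
      unfolding A_def using f c(1) unfolding holomorphic_fun_def
      by (meson holomorphic_on_subset image_mono inf_le2)
    moreover have "snd c p \<in> A" unfolding A_def using W(2) c(2) by blast
    moreover have "open A"
      unfolding A_def using chart_image_open_subset[OF c(1)] W chart_open[OF c(1)] by blast
    moreover have "deriv (f \<circ> chart_inv c) (snd c p) \<noteq> 0"
      using nz[OF c] unfolding chart_deriv_def .
    ultimately obtain r where r: "r > 0" "ball (snd c p) r \<subseteq> A"
      "open ((f \<circ> chart_inv c) ` ball (snd c p) r)" "inj_on (f \<circ> chart_inv c) (ball (snd c p) r)"
      by (rule has_complex_derivative_locally_invertible)
    define N where "N = {q \<in> fst c. snd c q \<in> ball (snd c p) r}"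
    have NW: "N \<subseteq> W"
    proof
      fix q assume q: "q \<in> N"
      then have "snd c q \<in> snd c ` (W \<inter> fst c)" using r(2) by (auto simp: N_def A_def)
      then show "q \<in> W" using q chart_inj[OF c(1)] by (auto simp: N_def inj_on_def)
    qed
    have img: "snd c ` N = ball (snd c p) r"
      using r(2) by (auto simp: N_def A_def)
    have inj: "inj_on f N"
    proof (rule inj_onI)
      fix q q' assume q: "q \<in> N" "q' \<in> N" "f q = f q'"
      then have "(f \<circ> chart_inv c) (snd c q) = (f \<circ> chart_inv c) (snd c q')"
        using chart_inv_left[OF c(1)] by (simp add: N_def)
      then have "snd c q = snd c q'"
        using r(4) q unfolding N_def inj_on_def by blast
      then show "q = q'" using q chart_inj[OF c(1)] by (auto simp: N_def inj_on_def)
    qed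
    have "f ` N = (f \<circ> chart_inv c) ` (snd c ` N)"
      using chart_inv_left[OF c(1)] by (force simp: N_def)
    then have "open (f ` N)" using r(3) img by simp
    moreover have "openin (topo S) N" unfolding N_def by (rule chart_preimage_open[OF c(1)]) simp
    moreover have "p \<in> N" using c r by (simp add: N_def)
    ultimately show ?thesis using NW inj by blast
  qed
  show "Hausdorff_space (topo S)" by (rule Hausdorff_S)
  show "continuous_map (topo S) euclidean f" using holomorphic_fun_continuous[OF f] .
  show "\<exists>N. openin (topo S) N \<and> p \<in> N \<and> inj_on f N" if "p \<in> points S" for p
    using inv[OF openin_topspace that] by (elim exE conjE) (intro exI conjI)
  show "open (f ` W)" if W: "openin (topo S) W" for W
  proof (subst open_subopen, clarify)
    fix p assume "p \<in> W"
    obtain N where "N \<subseteq> W" "p \<in> N" "open (f ` N)"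
      using inv[OF W \<open>p \<in> W\<close>] by (elim exE conjE)
    then show "\<exists>T. open T \<and> f p \<in> T \<and> T \<subseteq> f ` W" by blast
  qed
qed

text \<open>Seen in a chart, the section is a continuous right inverse of \<open>F\<close>, whose
  derivative does not vanish. So the section is differentiable with the reciprocal
  derivative.\<close>

lemma section_has_derivative:
  assumes f: "holomorphic_fun S f"
    and nz: "\<And>c p. c \<in> atlas S \<Longrightarrow> p \<in> fst c \<Longrightarrow> chart_deriv c f p \<noteq> 0"
    and \<sigma>: "local_section (topo S) f U \<sigma>" "open U" and u: "u \<in> U"
    and c: "c \<in> atlas S" "\<sigma> u \<in> fst c"
  shows "((snd c \<circ> \<sigma>) has_field_derivative inverse (chart_deriv c f (\<sigma> u))) (at u)"
proof -
  let ?T = "{u \<in> U. \<sigma> u \<in> fst c}"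
  have T: "open ?T" using local_section_open_preimage \<sigma> chart_open[OF c(1)] by blast
  have "continuous_map (top_of_set ?T) (subtopology (topo S) (fst c)) \<sigma>"
    using \<sigma>(1) local_section_subset[of "topo S" f U \<sigma> ?T]
    unfolding local_section_def continuous_map_in_subtopology by auto
  then have "continuous_map (top_of_set ?T) euclidean (snd c \<circ> \<sigma>)"
    using chart_continuous[OF c(1)] continuous_map_compose by blast
  then have "continuous_on ?T (snd c \<circ> \<sigma>)" by simp
  then have cont: "isCont (snd c \<circ> \<sigma>) u"
    using T u c(2) continuous_on_eq_continuous_at[OF T] by blast
  show ?thesis
  proof (rule has_field_derivative_inverse_basic[OF _ nz[OF c] cont T])
    show "((f \<circ> chart_inv c) has_field_derivative chart_deriv c f (\<sigma> u)) (at ((snd c \<circ> \<sigma>) u))"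
      using holomorphic_has_chart_deriv[OF f c] by simp
    show "u \<in> ?T" using u c by simp
    show "(f \<circ> chart_inv c) ((snd c \<circ> \<sigma>) z) = z" if "z \<in> ?T" for z
      using that chart_inv_left[OF c(1)] local_sectionD(1)[OF \<sigma>(1)] by simp
  qed
qed

end

section \<open>Curvature\<close>

lemma partial_has_derivative:
  assumes "(f has_derivative D) (at z)"
  shows "partial_u f z = D 1" "partial_v f z = D \<i>"
  using frechet_derivative_at[OF assms] by (simp_all add: partial_u_def partial_v_def)

text \<open>The right-hand side is the classical - (Laplacian of log E) / (2 E) for the conformal
  metric E |dz|^2, with the logarithm differentiated out.\<close>

lemma brioschi_isothermal:
  assumes "E z \<noteq> 0"
  shows "brioschi E (\<lambda>_. 0) E z =
    ((partial_u E z)\<^sup>2 + (partial_v E z)\<^sup>2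
      - E z * (partial_u (partial_u E) z + partial_v (partial_v E) z)) / (2 * E z ^ 3)"
proof -
  have "partial_u (\<lambda>_. 0) = (\<lambda>_. 0)" "partial_v (\<lambda>_. 0) = (\<lambda>_. 0)"
    by (auto simp: partial_u_def partial_v_def)
  then show ?thesis
    using assms unfolding brioschi_def det3_def
    by (simp add: field_simps power2_eq_square power3_eq_cube)
qed

text \<open>The Laplacian of E is 8 (|a'|^2 + |b'|^2), and the squared gradient is 16 times the
  squared modulus of the Hermitian product of (a', b') and (a, b). Lagrange's identity turns the
  numerator of the curvature into - 16 |a b' - b a'|^2. Squared moduli are written as real inner
  products so that they can be differentiated in the directions 1 and \<i>.\<close>

lemma brioschi_sum_of_squares:
  fixes a b :: "complex \<Rightarrow> complex"
  assumes U: "open U" "z \<in> U"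
    and a: "a holomorphic_on U" and b: "b holomorphic_on U"
    and E: "\<And>z. z \<in> U \<Longrightarrow> E z = 2 * ((cmod (a z))\<^sup>2 + (cmod (b z))\<^sup>2)"
    and nz: "E z \<noteq> 0"
  shows "brioschi E (\<lambda>_. 0) E z = - 8 * (cmod (a z * deriv b z - b z * deriv a z))\<^sup>2 / E z ^ 3"
proof -
  define a1 b1 a2 b2 where "a1 = deriv a" and "b1 = deriv b" and "a2 = deriv a1" and "b2 = deriv b1"
  have a1: "(a has_derivative (\<lambda>h. a1 z * h)) (at z)" and b1: "(b has_derivative (\<lambda>h. b1 z * h)) (at z)"
    if "z \<in> U" for z
    using holomorphic_derivI[OF a U(1) that] holomorphic_derivI[OF b U(1) that]
    unfolding has_field_derivative_def a1_def b1_def .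
  have "a1 holomorphic_on U" "b1 holomorphic_on U"
    unfolding a1_def b1_def using a b U(1) by (auto intro: holomorphic_deriv)
  note hol1 = this
  have a2: "(a1 has_derivative (\<lambda>h. a2 z * h)) (at z)" and b2: "(b1 has_derivative (\<lambda>h. b2 z * h)) (at z)"
    if "z \<in> U" for z
    using holomorphic_derivI[OF hol1(1) U(1) that] holomorphic_derivI[OF hol1(2) U(1) that]
    unfolding has_field_derivative_def a2_def b2_def .
  have Ed: "(E has_derivative (\<lambda>h. 4 * (a z \<bullet> (a1 z * h) + b z \<bullet> (b1 z * h)))) (at z)"
    if z: "z \<in> U" for z
  proof (rule has_derivative_transform_within_open)
    show "((\<lambda>z. 2 * (a z \<bullet> a z + b z \<bullet> b z)) has_derivative
        (\<lambda>h. 4 * (a z \<bullet> (a1 z * h) + b z \<bullet> (b1 z * h)))) (at z)"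
      by (rule has_derivative_eq_rhs, (rule derivative_intros a1[OF z] b1[OF z])+)
        (auto simp: fun_eq_iff inner_commute algebra_simps)
  qed (use U z E in \<open>auto simp: power2_norm_eq_inner\<close>)
  note pE = partial_has_derivative[OF Ed]
  have pu: "partial_u (partial_u E) z = 4 * (a1 z \<bullet> a1 z + a z \<bullet> a2 z + (b1 z \<bullet> b1 z + b z \<bullet> b2 z))"
  proof (rule trans[OF partial_has_derivative(1)])
    show "(partial_u E has_derivative (\<lambda>h. 4 * ((a1 z * h) \<bullet> a1 z + a z \<bullet> (a2 z * h)
        + ((b1 z * h) \<bullet> b1 z + b z \<bullet> (b2 z * h))))) (at z)"
    proof (rule has_derivative_transform_within_open)
      show "((\<lambda>z. 4 * (a z \<bullet> a1 z + b z \<bullet> b1 z)) has_derivative (\<lambda>h. 4 * ((a1 z * h) \<bullet> a1 z + a z \<bullet> (a2 z * h)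
        + ((b1 z * h) \<bullet> b1 z + b z \<bullet> (b2 z * h))))) (at z)"
        by (rule has_derivative_eq_rhs, (rule derivative_intros a1[OF U(2)] b1[OF U(2)] a2[OF U(2)] b2[OF U(2)])+)
          (auto simp: fun_eq_iff algebra_simps)
    qed (use U pE in auto)
  qed simp
  have pv: "partial_v (partial_v E) z = 4 * (a1 z \<bullet> a1 z - a z \<bullet> a2 z + (b1 z \<bullet> b1 z - b z \<bullet> b2 z))"
  proof (rule trans[OF partial_has_derivative(2)])
    show "(partial_v E has_derivative (\<lambda>h. 4 * ((a1 z * h) \<bullet> (a1 z * \<i>) + a z \<bullet> (a2 z * h * \<i>)
        + ((b1 z * h) \<bullet> (b1 z * \<i>) + b z \<bullet> (b2 z * h * \<i>))))) (at z)"
    proof (rule has_derivative_transform_within_open)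
      show "((\<lambda>z. 4 * (a z \<bullet> (a1 z * \<i>) + b z \<bullet> (b1 z * \<i>))) has_derivative
          (\<lambda>h. 4 * ((a1 z * h) \<bullet> (a1 z * \<i>) + a z \<bullet> (a2 z * h * \<i>)
        + ((b1 z * h) \<bullet> (b1 z * \<i>) + b z \<bullet> (b2 z * h * \<i>))))) (at z)"
        by (rule has_derivative_eq_rhs, (rule derivative_intros a1[OF U(2)] b1[OF U(2)] a2[OF U(2)] b2[OF U(2)])+)
          (auto simp: fun_eq_iff algebra_simps)
    qed (use U pE in auto)
  qed (simp add: inner_complex_def algebra_simps)
  \<comment> \<open>The terms with \<open>a2\<close> and \<open>b2\<close> cancel: in the direction
    \<i> the second derivative picks up the factor \<i>^2 = -1.\<close>
  have lap: "partial_u (partial_u E) z + partial_v (partial_v E) z = 8 * ((cmod (a1 z))\<^sup>2 + (cmod (b1 z))\<^sup>2)"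
    unfolding pu pv power2_norm_eq_inner by (simp add: algebra_simps)
  \<comment> \<open>Lagrange's identity for the vectors (a, b) and (a', b'), checked in real and
    imaginary parts.\<close>
  have key: "(partial_u E z)\<^sup>2 + (partial_v E z)\<^sup>2
      - E z * (8 * ((cmod (a1 z))\<^sup>2 + (cmod (b1 z))\<^sup>2)) = - 16 * (cmod (a z * b1 z - b z * a1 z))\<^sup>2"
    unfolding pE[OF U(2)] E[OF U(2)] cmod_power2 inner_complex_def
    by (simp add: power2_eq_square) (simp add: algebra_simps)
  show ?thesis
    unfolding brioschi_isothermal[of E z, OF nz] lap key unfolding a1_def b1_def by simp
qed

text \<open>Near \<open>z0\<close> the integrand exceeds \<open>f z0 / 2\<close>, and a ball has
  positive measure.\<close>

lemma lborel_open_integral_pos: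
  fixes f :: "complex \<Rightarrow> real"
  assumes A: "open A" "z0 \<in> A" and f: "continuous_on A f" "f z0 > 0"
  shows "(\<integral>\<^sup>+z\<in>A. ennreal (f z) \<partial>lborel) > 0"
proof -
  have o: "open (A \<inter> f -` {f z0 / 2<..})"
    by (rule continuous_open_preimage[OF f(1) A(1) open_greaterThan])
  have "z0 \<in> A \<inter> f -` {f z0 / 2<..}" using A(2) f(2) by simp
  from openE[OF o this] obtain r where r: "r > 0" "ball z0 r \<subseteq> A \<inter> f -` {f z0 / 2<..}" .
  have "0 < ennreal (f z0 / 2) * emeasure lborel (ball z0 r)"
    using f(2) r(1) by (simp add: emeasure_ball ennreal_zero_less_mult_iff unit_ball_vol_pos)
  also have "\<dots> = (\<integral>\<^sup>+z. ennreal (f z0 / 2) * indicator (ball z0 r) z \<partial>lborel)"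
    by (simp add: nn_integral_cmult_indicator)
  also have "\<dots> \<le> (\<integral>\<^sup>+z\<in>A. ennreal (f z) \<partial>lborel)"
    using r(2) by (intro nn_integral_mono) (auto simp: indicator_def intro!: ennreal_leI)
  finally show ?thesis .
qed

text \<open>Near \<open>z0\<close> the quotient v / u is defined, and the numerator of its
  derivative is the Wronskian. So the quotient is constant on a disc.\<close>

lemma zero_wronskian_local:
  fixes u v :: "complex \<Rightarrow> complex"
  assumes U: "open U" "z0 \<in> U" and u: "u holomorphic_on U" and v: "v holomorphic_on U"
    and nz: "u z0 \<noteq> 0" and W: "\<And>z. z \<in> U \<Longrightarrow> u z * deriv v z - v z * deriv u z = 0"
  shows "\<exists>r>0. ball z0 r \<subseteq> U \<and> (\<forall>z\<in>ball z0 r. u z0 * v z = v z0 * u z)"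
proof -
  have o: "open (U \<inter> u -` (- {0}))"
    by (rule continuous_open_preimage[OF holomorphic_on_imp_continuous_on[OF u] U(1)]) auto
  have "z0 \<in> U \<inter> u -` (- {0})" using U(2) nz by simp
  from openE[OF o this] obtain r where r: "r > 0" "ball z0 r \<subseteq> U \<inter> u -` (- {0})" .
  have "((\<lambda>z. v z / u z) has_field_derivative 0) (at z within ball z0 r)" if z: "z \<in> ball z0 r" for z
  proof -
    have zU: "z \<in> U" "u z \<noteq> 0" using r(2) z by auto
    have "((\<lambda>z. v z / u z) has_field_derivative (deriv v z * u z - v z * deriv u z) / (u z * u z)) (at z)"
      using DERIV_divide[OF holomorphic_derivI[OF v U(1) zU(1)] holomorphic_derivI[OF u U(1) zU(1)] zU(2)] .
    moreover have "deriv v z * u z - v z * deriv u z = 0"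
      using W[OF zU(1)] by (simp add: mult.commute)
    ultimately show ?thesis by (simp add: has_field_derivative_at_within)
  qed
  from has_field_derivative_zero_constant[OF convex_ball this]
  obtain c where c: "\<And>z. z \<in> ball z0 r \<Longrightarrow> v z / u z = c" by blast
  have "u z0 * v z = v z0 * u z" if z: "z \<in> ball z0 r" for z
  proof -
    have "u z \<noteq> 0" using r(2) z by auto
    moreover have "v z / u z = v z0 / u z0" using c z r(1) by simp
    ultimately show ?thesis using nz by (simp add: field_simps)
  qed
  then show ?thesis using r by auto
qed

text \<open>The values of \<open>f\<close> carry no topology, so the lemma applies to predicates on
  the surface as well as to functions.\<close>

lemma connected_space_locally_constant:
  assumes X: "connected_space X" and p: "p \<in> topspace X" "q \<in> topspace X"
    and loc: "\<And>p. p \<in> topspace X \<Longrightarrow> \<exists>N. openin X N \<and> p \<in> N \<and> (\<forall>q\<in>N. f q = f p)"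
  shows "f p = f q"
proof -
  have o: "openin X {x \<in> topspace X. P (f x)}" for P
  proof (subst openin_subopen, clarify)
    fix x assume x: "x \<in> topspace X" "P (f x)"
    then obtain N where N: "openin X N" "x \<in> N" "\<forall>q\<in>N. f q = f x" using loc by blast
    moreover have "N \<subseteq> {x \<in> topspace X. P (f x)}"
      using openin_subset[OF N(1)] N(3) x by auto
    ultimately show "\<exists>T. openin X T \<and> x \<in> T \<and> T \<subseteq> {x \<in> topspace X. P (f x)}" by blast
  qed
  have "topspace X - {x \<in> topspace X. f x = f p} = {x \<in> topspace X. f x \<noteq> f p}" by auto
  then have "closedin X {x \<in> topspace X. f x = f p}"
    unfolding closedin_def using o[of "\<lambda>y. y \<noteq> f p"] by auto
  then have "{x \<in> topspace X. f x = f p} = topspace X"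
    using o[of "\<lambda>y. y = f p"] X p unfolding connected_space_clopen_in by blast
  then show ?thesis using p by (metis (mono_tags, lifting) mem_Collect_eq)
qed

text \<open>The Wronskian of the coordinate derivatives F' and G'. Where F' does not vanish, it is
  F'^2 times the derivative of G' / F'.\<close>

definition chart_wronskian :: "'a chart \<Rightarrow> ('a \<Rightarrow> complex) \<Rightarrow> ('a \<Rightarrow> complex) \<Rightarrow> complex \<Rightarrow> complex" where
  "chart_wronskian c F G z =
     deriv (F \<circ> chart_inv c) z * deriv (deriv (G \<circ> chart_inv c)) z
     - deriv (G \<circ> chart_inv c) z * deriv (deriv (F \<circ> chart_inv c)) z"

lemma tau_form_coef:
  "coef (tau_form F G) c 1 \<i> = (\<lambda>_. 0)"
  "coef (tau_form F G) c \<i> \<i> = coef (tau_form F G) c 1 1"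
  "coef (tau_form F G) c 1 1 z =
    2 * ((cmod (chart_deriv c F (chart_inv c z)))\<^sup>2 + (cmod (chart_deriv c G (chart_inv c z)))\<^sup>2)"
  by (auto simp: coef_def tau_form_def Let_def fun_eq_iff cmod_power2 simp flip: power2_eq_square)

section \<open>The Wronskian as a cubic differential, and the consequences of its vanishing\<close>

context connected_riemann_surface
begin

lemma holomorphic_in_chart:
  assumes "holomorphic_fun S f" "c \<in> atlas S"
  shows "(f \<circ> chart_inv c) holomorphic_on snd c ` fst c"
    "deriv (f \<circ> chart_inv c) holomorphic_on snd c ` fst c"
    "deriv (deriv (f \<circ> chart_inv c)) holomorphic_on snd c ` fst c"
  using assms chart_image_open unfolding holomorphic_fun_def by (auto intro!: holomorphic_deriv)

text \<open>In the second derivatives, the terms containing the second derivative of the transition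
  map cancel by antisymmetry. What remains is the transformation law of a cubic differential, so
  vanishing does not depend on the chart.\<close>

lemma chart_wronskian_change:
  assumes F: "holomorphic_fun S F" and G: "holomorphic_fun S G"
    and c: "c \<in> atlas S" "c' \<in> atlas S" and p: "p \<in> fst c" "p \<in> fst c'"
  shows "chart_wronskian c F G (snd c p)
    = chart_deriv c (snd c') p ^ 3 * chart_wronskian c' F G (snd c' p)"
proof -
  define V where "V = snd c ` (fst c \<inter> fst c')"
  define \<phi> where "\<phi> = snd c' \<circ> chart_inv c"
  have V: "open V" "snd c p \<in> V" unfolding V_def using overlap_image_open[OF c] p by auto
  have \<phi>: "\<phi> holomorphic_on V" "deriv \<phi> holomorphic_on V"
    using transition_holomorphic[OF c] V(1) unfolding V_def \<phi>_def by (auto intro: holomorphic_deriv)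
  have \<phi>p: "\<phi> (snd c p) = snd c' p" unfolding \<phi>_def using chart_inv_left[OF c(1) p(1)] by simp
  have \<phi>V: "\<phi> z \<in> snd c' ` fst c'" if "z \<in> V" for z
    using that chart_inv_left[OF c(1)] unfolding V_def \<phi>_def by auto
  have d1: "deriv (f \<circ> chart_inv c) z = deriv (f \<circ> chart_inv c') (\<phi> z) * deriv \<phi> z"
    if f: "holomorphic_fun S f" and z: "z \<in> V" for f z
  proof -
    obtain q where q: "q \<in> fst c" "q \<in> fst c'" "z = snd c q" using z unfolding V_def by blast
    have "\<phi> z = snd c' q" unfolding \<phi>_def q(3) using chart_inv_left[OF c(1) q(1)] by simp
    then show ?thesis
      using chart_deriv_change[OF f c q(1,2)] unfolding chart_deriv_def \<phi>_def[symmetric] q(3) by simp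
  qed
  have d2: "deriv (deriv (f \<circ> chart_inv c)) (snd c p) =
      deriv (deriv (f \<circ> chart_inv c')) (snd c' p) * (deriv \<phi> (snd c p))\<^sup>2
      + deriv (f \<circ> chart_inv c') (snd c' p) * deriv (deriv \<phi>) (snd c p)"
    if f: "holomorphic_fun S f" for f
  proof (rule DERIV_imp_deriv, rule has_field_derivative_transform_within_open[OF _ V])
    let ?g = "deriv (f \<circ> chart_inv c')"
    have D0: "(?g has_field_derivative deriv ?g (\<phi> (snd c p))) (at (\<phi> (snd c p)))"
      using holomorphic_derivI[OF holomorphic_in_chart(2)[OF f c(2)] chart_image_open[OF c(2)] \<phi>V[OF V(2)]] .
    have D: "(?g \<circ> \<phi> has_field_derivative deriv ?g (\<phi> (snd c p)) * deriv \<phi> (snd c p)) (at (snd c p))"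
      using DERIV_chain[OF D0 holomorphic_derivI[OF \<phi>(1) V]] .
    show "((\<lambda>z. (?g \<circ> \<phi>) z * deriv \<phi> z) has_field_derivative
      deriv ?g (snd c' p) * (deriv \<phi> (snd c p))\<^sup>2 + ?g (snd c' p) * deriv (deriv \<phi>) (snd c p)) (at (snd c p))"
      using DERIV_mult[OF D holomorphic_derivI[OF \<phi>(2) V]] \<phi>p
      by (simp add: power2_eq_square ac_simps)
    show "(?g \<circ> \<phi>) z * deriv \<phi> z = deriv (f \<circ> chart_inv c) z" if "z \<in> V" for z
      using d1[OF f that] by simp
  qed
  show ?thesis
    unfolding chart_wronskian_def d1[OF F V(2)] d1[OF G V(2)] d2[OF F] d2[OF G] \<phi>p
    unfolding chart_deriv_def \<phi>_def[symmetric]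
    by (simp add: power2_eq_square power3_eq_cube algebra_simps)
qed

lemma tau_coef_in_chart:
  assumes "c \<in> atlas S" "z \<in> snd c ` fst c"
  shows "coef (tau_form F G) c 1 1 z =
    2 * ((cmod (deriv (F \<circ> chart_inv c) z))\<^sup>2 + (cmod (deriv (G \<circ> chart_inv c) z))\<^sup>2)"
  unfolding tau_form_coef chart_deriv_def chart_inv_right[OF assms] by simp

text \<open>The curvature is evaluated in a chart fixed by choice. The formula for sums of squares
  applies there, and the transformation law of the Wronskian carries the criterion to any other
  chart at the point.\<close>

lemma gaussian_curvature_tau:
  assumes F: "holomorphic_fun S F" and G: "holomorphic_fun S G"
    and imm: "\<And>c p. c \<in> atlas S \<Longrightarrow> p \<in> fst c \<Longrightarrow> (chart_deriv c F p, chart_deriv c G p) \<noteq> (0, 0)"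
    and p: "p \<in> points S"
  shows "gaussian_curvature S (tau_form F G) p \<le> 0"
    and "c \<in> charts_at S p \<Longrightarrow>
      gaussian_curvature S (tau_form F G) p = 0 \<longleftrightarrow> chart_wronskian c F G (snd c p) = 0"
proof -
  define c0 where "c0 = (SOME c. c \<in> charts_at S p)"
  have "c0 \<in> charts_at S p"
    unfolding c0_def using charts_at_nonempty[OF p] by (rule someI_ex)
  then have c0: "c0 \<in> atlas S" "p \<in> fst c0" using charts_atD by auto
  let ?E = "coef (tau_form F G) c0 1 1"
  let ?z = "snd c0 p"
  have z: "?z \<in> snd c0 ` fst c0" using c0 by blast
  have Epos: "?E ?z > 0"
    unfolding tau_form_coef chart_inv_left[OF c0]
    using imm[OF c0] by (auto simp: add_nonneg_pos add_pos_nonneg)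
  have K: "gaussian_curvature S (tau_form F G) p = - 8 * (cmod (chart_wronskian c0 F G ?z))\<^sup>2 / ?E ?z ^ 3"
    unfolding gaussian_curvature_def Let_def c0_def[symmetric] tau_form_coef(1,2) chart_wronskian_def
    using brioschi_sum_of_squares[OF chart_image_open[OF c0(1)] z holomorphic_in_chart(2)[OF F c0(1)]
        holomorphic_in_chart(2)[OF G c0(1)] tau_coef_in_chart[OF c0(1)]] Epos by simp
  show "gaussian_curvature S (tau_form F G) p \<le> 0"
    unfolding K using Epos by (simp add: divide_nonpos_pos)
  assume "c \<in> charts_at S p"
  then have c: "c \<in> atlas S" "p \<in> fst c" using charts_atD by auto
  show "gaussian_curvature S (tau_form F G) p = 0 \<longleftrightarrow> chart_wronskian c F G (snd c p) = 0"
    unfolding K chart_wronskian_change[OF F G c(1) c0(1) c(2) c0(2)]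
    using Epos transition_deriv_nonzero[OF c(1) c0(1) c(2) c0(2)] by simp
qed

text \<open>A nonnegative function with integral 0 vanishes almost everywhere. A nonzero value of
  the Wronskian would make the curvature nonzero on a nonempty open set, and such a set has positive
  area.\<close>

lemma total_curvature_zero_imp_wronskian_zero:
  assumes F: "holomorphic_fun S F" and G: "holomorphic_fun S G"
    and imm: "\<And>c p. c \<in> atlas S \<Longrightarrow> p \<in> fst c \<Longrightarrow> (chart_deriv c F p, chart_deriv c G p) \<noteq> (0, 0)"
    and K: "has_total_curvature S F G 0" and c: "c \<in> atlas S" and z: "z \<in> snd c ` fst c"
  shows "chart_wronskian c F G z = 0"
proof (rule ccontr)
  assume W: "chart_wronskian c F G z \<noteq> 0"
  let ?K = "gaussian_curvature S (tau_form F G)" and ?E = "coef (tau_form F G) c 1 1"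
  obtain M where M: "area_measure S (tau_form F G) M" and int: "has_bochner_integral M ?K 0"
    using K unfolding has_total_curvature_def by blast
  have space: "space M = points S" and sets: "sets M = sigma_sets (points S) {U. openin (topo S) U}"
    using M unfolding area_measure_def by auto
  have "integrable M (\<lambda>x. - ?K x)" "integral\<^sup>L M (\<lambda>x. - ?K x) = 0"
    using int by (auto simp: has_bochner_integral_iff)
  moreover have "AE x in M. 0 \<le> - ?K x"
    using gaussian_curvature_tau(1)[OF F G imm] space by (auto intro!: AE_I2)
  ultimately have "AE x in M. - ?K x = 0"
    using integral_nonneg_eq_0_iff_AE by blast
  then obtain N where N: "{x \<in> space M. \<not> - ?K x = 0} \<subseteq> N" "emeasure M N = 0" "N \<in> sets M"
    by (rule AE_E)
  define B where "B = snd c ` fst c \<inter> chart_wronskian c F G -` (- {0})"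
  have "chart_wronskian c F G holomorphic_on snd c ` fst c"
    unfolding chart_wronskian_def using holomorphic_in_chart[OF F c] holomorphic_in_chart[OF G c]
    by (intro holomorphic_intros chart_image_open[OF c])
  then have B: "open B"
    unfolding B_def
    by (intro continuous_open_preimage holomorphic_on_imp_continuous_on chart_image_open[OF c]) auto
  define A where "A = {p \<in> fst c. snd c p \<in> B}"
  have A: "openin (topo S) A" unfolding A_def using chart_preimage_open[OF c B] .
  then have "A \<in> sets M" unfolding sets by blast
  have img: "snd c ` A = B" unfolding A_def B_def by auto
  have "A \<subseteq> N"
  proof
    fix p assume p: "p \<in> A"
    then have pc: "c \<in> charts_at S p" "p \<in> points S"
      using c chart_subset[OF c] by (auto simp: A_def charts_at_def)
    have "?K p \<noteq> 0"
      using gaussian_curvature_tau(2)[OF F G imm pc(2,1)] p by (simp add: A_def B_def)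
    then show "p \<in> N" using N(1) pc(2) space by auto
  qed
  then have "emeasure M A = 0"
    using N(2,3) emeasure_mono by (metis le_zero_eq)
  \<comment> \<open>The metric is conformal, so the area density is the square root of E^2 with no
    mixed term.\<close>
  moreover have "emeasure M A = (\<integral>\<^sup>+z\<in>snd c ` A. ennreal (sqrt (?E z * ?E z - 0\<^sup>2)) \<partial>lborel)"
  proof -
    have "A \<subseteq> fst c" by (auto simp: A_def)
    then show ?thesis
      using M c \<open>A \<in> sets M\<close> unfolding area_measure_def tau_form_coef(1,2) by blast
  qed
  moreover have "(\<integral>\<^sup>+z\<in>snd c ` A. ennreal (sqrt (?E z * ?E z - 0\<^sup>2)) \<partial>lborel) > 0"
    unfolding img
  proof (rule lborel_open_integral_pos[OF B])
    show zB: "z \<in> B" using z W by (simp add: B_def)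
    have "continuous_on (snd c ` fst c) (\<lambda>z. 2 * ((cmod (deriv (F \<circ> chart_inv c) z))\<^sup>2
        + (cmod (deriv (G \<circ> chart_inv c) z))\<^sup>2))"
      using holomorphic_in_chart(2)[OF F c] holomorphic_in_chart(2)[OF G c]
      by (intro continuous_intros holomorphic_on_imp_continuous_on)
    then have "continuous_on (snd c ` fst c) ?E"
      by (rule continuous_on_eq) (simp add: tau_coef_in_chart[OF c])
    then have "continuous_on B ?E" by (rule continuous_on_subset) (auto simp: B_def)
    then show "continuous_on B (\<lambda>z. sqrt (?E z * ?E z - 0\<^sup>2))"
      by (intro continuous_intros)
    have "?E z > 0"
      unfolding tau_form_coef using imm[OF c chart_inv_in[OF c z]]
      by (auto simp: add_nonneg_pos add_pos_nonneg)
    then show "sqrt (?E z * ?E z - 0\<^sup>2) > 0" by simp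
  qed
  ultimately show False by simp
qed

text \<open>The constants are the derivatives of \<open>F\<close> and \<open>G\<close> at a base
  point in one chart. The relation b dF = a dG holds at that point. Its truth value is locally
  constant: failure is an open condition, and where it holds the vanishing Wronskian propagates it
  to a disc. Connectedness does the rest.\<close>

lemma zero_wronskian_imp_proportional:
  assumes F: "holomorphic_fun S F" and G: "holomorphic_fun S G"
    and imm: "\<And>c p. c \<in> atlas S \<Longrightarrow> p \<in> fst c \<Longrightarrow> (chart_deriv c F p, chart_deriv c G p) \<noteq> (0, 0)"
    and W: "\<And>c z. c \<in> atlas S \<Longrightarrow> z \<in> snd c ` fst c \<Longrightarrow> chart_wronskian c F G z = 0"
  obtains a b where "(a, b) \<noteq> (0, 0)"
    "\<And>c p. c \<in> atlas S \<Longrightarrow> p \<in> fst c \<Longrightarrow> b * chart_deriv c F p = a * chart_deriv c G p"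
proof -
  obtain p0 c0 where p0: "p0 \<in> points S" "c0 \<in> atlas S" "p0 \<in> fst c0"
    using points_nonempty charts_cover by blast
  define a b where "a = chart_deriv c0 F p0" and "b = chart_deriv c0 G p0"
  \<comment> \<open>Quantifying over all charts at the point makes the relation a predicate on the
    surface; it is enough to test it in one chart.\<close>
  define P where "P p \<longleftrightarrow> (\<forall>c\<in>charts_at S p. b * chart_deriv c F p = a * chart_deriv c G p)" for p
  have P: "P p \<longleftrightarrow> b * chart_deriv c F p = a * chart_deriv c G p" if c: "c \<in> atlas S" "p \<in> fst c" for c p
  proof
    assume "P p" then show "b * chart_deriv c F p = a * chart_deriv c G p"
      using c unfolding P_def charts_at_def by blast
  next
    assume eq: "b * chart_deriv c F p = a * chart_deriv c G p"
    show "P p"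
      unfolding P_def
    proof
      fix c' assume "c' \<in> charts_at S p"
      then have c': "c' \<in> atlas S" "p \<in> fst c'" using charts_atD by auto
      show "b * chart_deriv c' F p = a * chart_deriv c' G p"
        unfolding chart_deriv_change[OF F c'(1) c(1) c'(2) c(2)] chart_deriv_change[OF G c'(1) c(1) c'(2) c(2)]
        using eq by (metis mult.assoc)
    qed
  qed
  have loc: "\<exists>N. openin (topo S) N \<and> p \<in> N \<and> (\<forall>q\<in>N. P q = P p)" if p: "p \<in> points S" for p
  proof -
    obtain c where c: "c \<in> atlas S" "p \<in> fst c" using charts_cover p by blast
    let ?U = "snd c ` fst c" and ?f = "deriv (F \<circ> chart_inv c)" and ?g = "deriv (G \<circ> chart_inv c)"
    have z0: "snd c p \<in> ?U" using c(2) by blast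
    have Pz: "P q \<longleftrightarrow> b * ?f (snd c q) = a * ?g (snd c q)" if "q \<in> fst c" for q
      using P[OF c(1) that] unfolding chart_deriv_def .
    have "\<exists>V. open V \<and> snd c p \<in> V \<and> (\<forall>z\<in>V. (b * ?f z = a * ?g z) = (b * ?f (snd c p) = a * ?g (snd c p)))"
    proof (cases "b * ?f (snd c p) = a * ?g (snd c p)")
      case False
      have "open (?U \<inter> (\<lambda>z. b * ?f z - a * ?g z) -` (- {0}))"
        using holomorphic_in_chart(2)[OF F c(1)] holomorphic_in_chart(2)[OF G c(1)]
        by (intro continuous_open_preimage chart_image_open[OF c(1)] continuous_intros
            holomorphic_on_imp_continuous_on) auto
      then show ?thesis
        using False z0
        by (intro exI[of _ "?U \<inter> (\<lambda>z. b * ?f z - a * ?g z) -` (- {0})"]) auto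
    next
      case True
      have imm': "?f (snd c p) \<noteq> 0 \<or> ?g (snd c p) \<noteq> 0"
        using imm[OF c] unfolding chart_deriv_def by auto
      have W1: "?f z * deriv ?g z - ?g z * deriv ?f z = 0" if "z \<in> ?U" for z
        using W[OF c(1) that] unfolding chart_wronskian_def .
      have W2: "?g z * deriv ?f z - ?f z * deriv ?g z = 0" if "z \<in> ?U" for z
        using W1[OF that] by (simp add: algebra_simps)
      note fg = holomorphic_in_chart(2)[OF F c(1)] holomorphic_in_chart(2)[OF G c(1)]
      \<comment> \<open>By the immersion condition one of the two derivatives is nonzero at the
        point. The quotient argument uses that one as denominator, and exchanging the roles only
        changes the sign of the Wronskian.\<close>
      obtain r where r: "r > 0" "\<forall>z\<in>ball (snd c p) r. ?f (snd c p) * ?g z = ?g (snd c p) * ?f z"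
      proof (cases "?f (snd c p) = 0")
        case False
        show thesis
          using zero_wronskian_local[OF chart_image_open[OF c(1)] z0 fg False W1] that by blast
      next
        case f0: True
        then have "?g (snd c p) \<noteq> 0" using imm' by simp
        from zero_wronskian_local[OF chart_image_open[OF c(1)] z0 fg(2,1) this W2]
        show thesis using that by metis
      qed
      have "b * ?f z = a * ?g z" if z: "z \<in> ball (snd c p) r" for z
      proof -
        have e: "?f (snd c p) * ?g z = ?g (snd c p) * ?f z" using r(2) z by blast
        \<comment> \<open>The desired equation is obtained after multiplication by each of the two
          derivatives at the point, one of which can be cancelled.\<close>
        have "?f (snd c p) * (b * ?f z) = ?f (snd c p) * (a * ?g z)"
          "?g (snd c p) * (b * ?f z) = ?g (snd c p) * (a * ?g z)"
          using e True by algebra+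
        then show ?thesis using imm' by auto
      qed
      then show ?thesis using True r(1) by (intro exI[of _ "ball (snd c p) r"]) auto
    qed
    then obtain V where V: "open V" "snd c p \<in> V"
      "\<forall>z\<in>V. (b * ?f z = a * ?g z) = (b * ?f (snd c p) = a * ?g (snd c p))"
      by (elim exE conjE)
    show ?thesis
    proof (intro exI conjI ballI)
      show "openin (topo S) {q \<in> fst c. snd c q \<in> V}"
        by (rule chart_preimage_open[OF c(1) V(1)])
      show "p \<in> {q \<in> fst c. snd c q \<in> V}" using c(2) V(2) by simp
      show "P q = P p" if "q \<in> {q \<in> fst c. snd c q \<in> V}" for q
      proof -
        have "q \<in> fst c" "snd c q \<in> V" using that by auto
        then show ?thesis
          unfolding Pz[OF \<open>q \<in> fst c\<close>] Pz[OF c(2)] using V(3) by (rule_tac bspec)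
      qed
    qed
  qed
  have "P p0" using P[OF p0(2,3)] unfolding a_def b_def by (simp add: mult.commute)
  then have "P p" if "p \<in> points S" for p
    using connected_space_locally_constant[OF connected_S p0(1) that loc] by blast
  then have "b * chart_deriv c F p = a * chart_deriv c G p" if "c \<in> atlas S" "p \<in> fst c" for c p
    using P[OF that] chart_subset that by blast
  moreover have "(a, b) \<noteq> (0, 0)" using imm[OF p0(2,3)] by (auto simp: a_def b_def)
  ultimately show thesis using that by blast
qed

lemma chart_deriv_zero_imp_constant:
  assumes f: "holomorphic_fun S f"
    and 0: "\<And>c p. c \<in> atlas S \<Longrightarrow> p \<in> fst c \<Longrightarrow> chart_deriv c f p = 0"
    and p: "p \<in> points S" "q \<in> points S"
  shows "f p = f q"
proof (rule connected_space_locally_constant[OF connected_S p])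
  fix p assume p: "p \<in> points S"
  obtain c where c: "c \<in> atlas S" "p \<in> fst c" using charts_cover p by blast
  obtain r where r: "r > 0" "ball (snd c p) r \<subseteq> snd c ` fst c"
    using openE[OF chart_image_open[OF c(1)] imageI[OF c(2)]] .
  have "((f \<circ> chart_inv c) has_field_derivative 0) (at z within ball (snd c p) r)"
    if z: "z \<in> ball (snd c p) r" for z
  proof -
    obtain q where q: "q \<in> fst c" "z = snd c q" using z r(2) by blast
    show ?thesis
      using holomorphic_has_chart_deriv[OF f c(1) q(1)] 0[OF c(1) q(1)] q(2)
      by (simp add: has_field_derivative_at_within)
  qed
  from has_field_derivative_zero_constant[OF convex_ball this]
  obtain k where k: "\<And>z. z \<in> ball (snd c p) r \<Longrightarrow> (f \<circ> chart_inv c) z = k" by blast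
  have "f q = k" if "q \<in> fst c" "snd c q \<in> ball (snd c p) r" for q
    using k[OF that(2)] chart_inv_left[OF c(1) that(1)] by simp
  then show "\<exists>N. openin (topo S) N \<and> p \<in> N \<and> (\<forall>q\<in>N. f q = f p)"
    using chart_preimage_open[OF c(1) open_ball, of "snd c p" r] c(2) r(1)
    by (intro exI[of _ "{q \<in> fst c. snd c q \<in> ball (snd c p) r}"]) simp
qed

end

section \<open>Metrics and curves\<close>

text \<open>The derivative may be unbounded near the exceptional points. If its norm has infinite
  integral, nothing is to be shown; otherwise it is integrable, and the fundamental theorem of
  calculus with finitely many exceptions applies.\<close>

lemma norm_increment_le_nn_integral:
  fixes f f' :: "real \<Rightarrow> complex"
  assumes ab: "a \<le> b" and E: "finite E" and f: "continuous_on {a..b} f"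
    and f': "\<And>x. x \<in> {a<..<b} - E \<Longrightarrow> (f has_vector_derivative f' x) (at x)"
    and cont: "continuous_on ({a<..<b} - E) f'"
  shows "ennreal (cmod (f b - f a)) \<le> (\<integral>\<^sup>+x\<in>{a<..<b} - E. ennreal (cmod (f' x)) \<partial>lborel)"
proof -
  define A where "A = {a<..<b} - E"
  \<comment> \<open>The derivative extended by 0 to the whole line, so that one function serves both
    the Lebesgue and the gauge integral.\<close>
  define g where "g x = indicator A x *\<^sub>R f' x" for x
  have A: "A \<in> sets borel"
    unfolding A_def using E by (simp add: finite_imp_closed open_Diff)
  have g: "g \<in> borel_measurable borel"
    unfolding g_def using borel_measurable_continuous_on_indicator[OF A] cont by (simp add: A_def)
  have eq: "(\<integral>\<^sup>+x. ennreal (norm (g x)) \<partial>lborel) = (\<integral>\<^sup>+x\<in>A. ennreal (cmod (f' x)) \<partial>lborel)"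
    by (rule nn_integral_cong) (simp add: g_def indicator_def)
  show ?thesis
  proof (cases "(\<integral>\<^sup>+x. ennreal (norm (g x)) \<partial>lborel) < \<infinity>")
    case True
    have int: "integrable lborel g"
      using g True by (intro integrableI_bounded) auto
    have "(g has_integral (f b - f a)) {a..b}"
      using fundamental_theorem_of_calculus_interior_strong[OF E ab _ f, of g] f'
      by (auto simp: g_def A_def)
    then have "((\<lambda>x. if x \<in> {a..b} then g x else 0) has_integral (f b - f a)) UNIV"
      by (simp only: has_integral_restrict_UNIV)
    moreover have "(\<lambda>x. if x \<in> {a..b} then g x else 0) = g"
      by (auto simp: g_def A_def fun_eq_iff)
    ultimately have "(g has_integral (f b - f a)) UNIV" by simp
    then have "integral\<^sup>L lborel g = f b - f a"
      using has_integral_integral_lborel[OF int] has_integral_unique by blast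
    then show ?thesis
      using integral_norm_bound_ennreal[OF int] eq unfolding A_def by simp
  next
    case False
    then show ?thesis using eq unfolding A_def by (simp add: not_less top_unique)
  qed
qed

text \<open>To be applied with \<open>h\<close> = T + ds^2. The comparison with |dF|^2 is assumed
  from above only, since a lower one holds locally for every Riemannian metric.\<close>

locale complete_immersion = connected_riemann_surface S for S :: "'a surface" +
  fixes F :: "'a \<Rightarrow> complex" and h :: "'a form" and C :: real
  assumes hol: "holomorphic_fun S F"
    and immersion: "c \<in> atlas S \<Longrightarrow> p \<in> fst c \<Longrightarrow> chart_deriv c F p \<noteq> 0"
    and complete: "complete_riemannian_metric S h"
    and bound: "c \<in> atlas S \<Longrightarrow> p \<in> fst c \<Longrightarrow> h c p v v \<le> C * (cmod (chart_deriv c F p * v))\<^sup>2"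

text \<open>Continuity of a form is given for fixed tangent vectors only. The expansion into three
  coefficients yields joint continuity in the point and the vector.\<close>

lemma bilinear_complex_expand:
  fixes B :: "complex \<Rightarrow> complex \<Rightarrow> real"
  assumes "bilinear B" "\<And>v w. B v w = B w v"
  shows "B v v = (Re v)\<^sup>2 * B 1 1 + 2 * Re v * Im v * B 1 \<i> + (Im v)\<^sup>2 * B \<i> \<i>"
proof -
  have v: "v = Re v *\<^sub>R 1 + Im v *\<^sub>R \<i>" by (simp add: complex_eq_iff)
  have "B v v = B (Re v *\<^sub>R 1 + Im v *\<^sub>R \<i>) (Re v *\<^sub>R 1 + Im v *\<^sub>R \<i>)"
    using v by simp
  also have "\<dots> = (Re v)\<^sup>2 * B 1 1 + 2 * Re v * Im v * B 1 \<i> + (Im v)\<^sup>2 * B \<i> \<i>"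
    using assms(2)[of \<i> 1]
    by (simp only: bilinear_ladd[OF assms(1)] bilinear_radd[OF assms(1)] bilinear_lmul[OF assms(1)]
        bilinear_rmul[OF assms(1)]) (simp add: power2_eq_square algebra_simps)
  finally show ?thesis .
qed

section \<open>Comparison of a Riemannian metric with |dF|^2\<close>

context connected_riemann_surface
begin

text \<open>The quotient of \<open>h\<close> by |dF|^2 is continuous and positive on the compact
  product of a closed coordinate disc and the unit circle of directions. Its minimum and maximum
  there are the two constants.\<close>

lemma metric_locally_comparable:
  assumes h: "riemannian_metric S h" and F: "holomorphic_fun S F"
    and imm: "\<forall>c\<in>atlas S. \<forall>p\<in>fst c. chart_deriv c F p \<noteq> 0"
    and p: "p \<in> points S"
  shows "\<exists>N m M. openin (topo S) N \<and> p \<in> N \<and> 0 < m \<and>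
    (\<forall>q\<in>N. \<forall>c\<in>charts_at S q. \<forall>v. m * (cmod (chart_deriv c F q * v))\<^sup>2 \<le> h c q v v \<and>
       h c q v v \<le> M * (cmod (chart_deriv c F q * v))\<^sup>2)"
proof -
  obtain c where c: "c \<in> atlas S" "p \<in> fst c" using charts_cover p by blast
  have imm_c: "chart_deriv c F q \<noteq> 0" if "q \<in> fst c" for q
    using imm c(1) that by blast
  have symb: "sym_bilinear_form S h" using h unfolding riemannian_metric_def by blast
  have bil: "bilinear (h c q)" "h c q v w = h c q w v" if "q \<in> fst c" for q v w
    using symb c(1) that unfolding sym_bilinear_form_def by blast+
  have pos: "h c q v v > 0" if "q \<in> fst c" "v \<noteq> 0" for q v
    using h c(1) that unfolding riemannian_metric_def by blast
  define H where "H v w z = h c (chart_inv c z) v w" for v w z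
  have H: "continuous_on (snd c ` fst c) (H v w)" for v w
  proof -
    have "Ck_on 0 (\<lambda>z. h c (chart_inv c z) v w) (snd c ` fst c)"
      using symb c(1) unfolding sym_bilinear_form_def by blast
    then show ?thesis unfolding H_def by simp
  qed
  define d where "d = deriv (F \<circ> chart_inv c)"
  have d: "continuous_on (snd c ` fst c) d"
    unfolding d_def using holomorphic_in_chart(2)[OF F c(1)] holomorphic_on_imp_continuous_on by blast
  have dF: "chart_deriv c F q = d (snd c q)" for q
    unfolding chart_deriv_def d_def ..
  obtain r where r: "r > 0" "cball (snd c p) r \<subseteq> snd c ` fst c"
    using chart_image_open[OF c(1)] c(2) unfolding open_contains_cball by auto
  define K where "K = cball (snd c p) r \<times> sphere (0::complex) 1"
  \<comment> \<open>The quotient as a function of position and direction. The numerator is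
    \<open>h c q v v\<close>, spelled out through its coefficients.\<close>
  define \<Phi> where "\<Phi> x = ((Re (snd x))\<^sup>2 * H 1 1 (fst x) + 2 * Re (snd x) * Im (snd x) * H 1 \<i> (fst x)
      + (Im (snd x))\<^sup>2 * H \<i> \<i> (fst x)) / (cmod (d (fst x)))\<^sup>2" for x
  have K: "compact K" unfolding K_def by (intro compact_Times compact_cball compact_sphere)
  have "(snd c p, 1) \<in> K" unfolding K_def using r(1) by simp
  then have ne: "K \<noteq> {}" by blast
  have in_img: "fst x \<in> snd c ` fst c" if "x \<in> K" for x
    using that r(2) unfolding K_def by (auto simp: mem_Times_iff)
  have \<Phi>: "\<Phi> (snd c q, v) = h c q v v / (cmod (chart_deriv c F q))\<^sup>2" if "q \<in> fst c" for q v
    unfolding \<Phi>_def H_def fst_conv snd_conv dF chart_inv_left[OF c(1) that]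
    using bilinear_complex_expand[of "h c q" v, OF bil[OF that]] by simp
  have dnz: "d z \<noteq> 0" if "z \<in> snd c ` fst c" for z
    using imm_c that unfolding dF by blast
  have "continuous_on K \<Phi>"
    unfolding \<Phi>_def
    by (intro continuous_intros continuous_on_compose2[OF H] continuous_on_compose2[OF d])
      (use in_img dnz in auto)
  then obtain x0 x1 where x: "x0 \<in> K" "x1 \<in> K" "\<And>y. y \<in> K \<Longrightarrow> \<Phi> x0 \<le> \<Phi> y \<and> \<Phi> y \<le> \<Phi> x1"
    using continuous_attains_inf[OF K ne] continuous_attains_sup[OF K ne] by blast
  have m: "\<Phi> x0 > 0"
  proof -
    obtain q where q: "q \<in> fst c" "fst x0 = snd c q" using in_img[OF x(1)] by blast
    have "snd x0 \<noteq> 0" using x(1) unfolding K_def by (auto simp: mem_Times_iff)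
    moreover have "x0 = (snd c q, snd x0)" using q(2) by (simp add: prod_eq_iff)
    ultimately show ?thesis
      using \<Phi>[OF q(1), of "snd x0"] pos[OF q(1)] imm_c[OF q(1)] by simp
  qed
  have main: "\<Phi> x0 * (cmod (chart_deriv c F q * v))\<^sup>2 \<le> h c q v v \<and>
      h c q v v \<le> \<Phi> x1 * (cmod (chart_deriv c F q * v))\<^sup>2"
    if q: "q \<in> fst c" "snd c q \<in> cball (snd c p) r" for q v
  proof (cases "v = 0")
    case True
    have "h c q 0 0 = 0" using bilinear_lzero[OF bil(1)[OF q(1)]] .
    then show ?thesis using True by simp
  next
    case False
    define w where "w = v /\<^sub>R cmod v"
    have w: "cmod w = 1" "v = cmod v *\<^sub>R w" using False by (simp_all add: w_def)
    have hv: "h c q v v = (cmod v)\<^sup>2 * h c q w w"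
      by (subst (1 2) w(2))
        (simp add: bilinear_lmul[OF bil(1)[OF q(1)]] bilinear_rmul[OF bil(1)[OF q(1)]] power2_eq_square)
    have "(snd c q, w) \<in> K" using q(2) w(1) unfolding K_def by simp
    from x(3)[OF this] have "\<Phi> x0 \<le> h c q w w / (cmod (chart_deriv c F q))\<^sup>2"
      "h c q w w / (cmod (chart_deriv c F q))\<^sup>2 \<le> \<Phi> x1"
      unfolding \<Phi>[OF q(1)] by auto
    then have *: "\<Phi> x0 * (cmod (chart_deriv c F q))\<^sup>2 \<le> h c q w w"
      "h c q w w \<le> \<Phi> x1 * (cmod (chart_deriv c F q))\<^sup>2"
      using imm_c[OF q(1)] by (simp_all add: field_simps)
    show ?thesis
      using mult_left_mono[OF *(1) zero_le_power2[of "cmod v"]]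
        mult_left_mono[OF *(2) zero_le_power2[of "cmod v"]]
      unfolding hv norm_mult power_mult_distrib by (simp add: mult_ac)
  qed
  \<comment> \<open>The transformation law carries both inequalities from \<open>c\<close> to every
    other chart at the point.\<close>
  let ?N = "{q \<in> fst c. snd c q \<in> ball (snd c p) r}"
  have "\<Phi> x0 * (cmod (chart_deriv c' F q * v))\<^sup>2 \<le> h c' q v v \<and>
      h c' q v v \<le> \<Phi> x1 * (cmod (chart_deriv c' F q * v))\<^sup>2"
    if q: "q \<in> ?N" and c': "c' \<in> charts_at S q" for q c' v
  proof -
    have c'': "c' \<in> atlas S" "q \<in> fst c'" and qc: "q \<in> fst c" using charts_atD c' q by auto
    have "h c' q v v = h c q (chart_deriv c' (snd c) q * v) (chart_deriv c' (snd c) q * v)"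
      using symb c'' c(1) qc unfolding sym_bilinear_form_def by blast
    moreover have "chart_deriv c' F q * v = chart_deriv c F q * (chart_deriv c' (snd c) q * v)"
      using chart_deriv_change[OF F c''(1) c(1) c''(2) qc] by simp
    moreover have "snd c q \<in> cball (snd c p) r" using q by simp
    ultimately show ?thesis
      using main[OF qc, of "chart_deriv c' (snd c) q * v"] by metis
  qed
  moreover have "openin (topo S) ?N" by (rule chart_preimage_open[OF c(1)]) simp
  moreover have "p \<in> ?N" using c(2) r(1) by simp
  ultimately show ?thesis using m by blast
qed

text \<open>Finitely many neighbourhoods with local bounds cover the compact set. This absorbs a
  form of compact support, about whose size nothing is known.\<close>

lemma metric_bounded_outside_compact:
  assumes h: "riemannian_metric S h" and F: "holomorphic_fun S F"
    and imm: "\<forall>c\<in>atlas S. \<forall>p\<in>fst c. chart_deriv c F p \<noteq> 0"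
    and K: "compactin (topo S) K"
    and out: "\<And>c p v. c \<in> atlas S \<Longrightarrow> p \<in> fst c \<Longrightarrow> p \<notin> K \<Longrightarrow>
      h c p v v \<le> C0 * (cmod (chart_deriv c F p * v))\<^sup>2"
  shows "\<exists>C. \<forall>c\<in>atlas S. \<forall>p\<in>fst c. \<forall>v. h c p v v \<le> C * (cmod (chart_deriv c F p * v))\<^sup>2"
proof -
  have Ksub: "K \<subseteq> points S" using K compactin_subset_topspace by blast
  define B where "B N M \<longleftrightarrow> (\<forall>q\<in>N. \<forall>c\<in>charts_at S q. \<forall>v.
    h c q v v \<le> M * (cmod (chart_deriv c F q * v))\<^sup>2)" for N M
  have "K \<subseteq> \<Union>{N. openin (topo S) N \<and> (\<exists>M. B N M)}"
  proof
    fix p assume "p \<in> K"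
    then have p: "p \<in> points S" using Ksub by blast
    from metric_locally_comparable[OF h F imm p]
    obtain N m M where "openin (topo S) N" "p \<in> N"
      "\<forall>q\<in>N. \<forall>c\<in>charts_at S q. \<forall>v. m * (cmod (chart_deriv c F q * v))\<^sup>2 \<le> h c q v v \<and>
         h c q v v \<le> M * (cmod (chart_deriv c F q * v))\<^sup>2"
      by (elim exE conjE)
    moreover from this(3) have "B N M" unfolding B_def by blast
    ultimately show "p \<in> \<Union>{N. openin (topo S) N \<and> (\<exists>M. B N M)}" by blast
  qed
  then obtain P where P: "finite P" "P \<subseteq> {N. openin (topo S) N \<and> (\<exists>M. B N M)}" "K \<subseteq> \<Union>P"
    using K unfolding compactin_def by (metis (no_types, lifting) mem_Collect_eq)
  then have "\<forall>N\<in>P. \<exists>M. B N M" by blast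
  from bchoice[OF this] obtain M where M: "\<And>N. N \<in> P \<Longrightarrow> B N (M N)" by blast
  \<comment> \<open>A common upper bound for \<open>C0\<close> and all \<open>M N\<close>. Absolute
    values are taken because the signs of these constants are not assumed.\<close>
  define C where "C = \<bar>C0\<bar> + (\<Sum>N\<in>P. \<bar>M N\<bar>)"
  have "h c p v v \<le> C * (cmod (chart_deriv c F p * v))\<^sup>2" if c: "c \<in> atlas S" "p \<in> fst c" for c p v
  proof -
    have "\<exists>C'\<le>C. h c p v v \<le> C' * (cmod (chart_deriv c F p * v))\<^sup>2"
    proof (cases "p \<in> K")
      case False
      have "C0 \<le> C" unfolding C_def by (smt (verit) sum_nonneg)
      then show ?thesis using out[OF c False] by blast
    next
      case True
      then obtain N where N: "N \<in> P" "p \<in> N" using P(3) by blast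
      have "\<bar>M N\<bar> \<le> (\<Sum>N\<in>P. \<bar>M N\<bar>)" using P(1) N(1) by (intro member_le_sum) auto
      then have "M N \<le> C" unfolding C_def by linarith
      moreover have "c \<in> charts_at S p" using c by (simp add: charts_at_def)
      then have "h c p v v \<le> M N * (cmod (chart_deriv c F p * v))\<^sup>2"
        using M[OF N(1)] N(2) unfolding B_def by blast
      ultimately show ?thesis by blast
    qed
    then obtain C' where "C' \<le> C" "h c p v v \<le> C' * (cmod (chart_deriv c F p * v))\<^sup>2" by blast
    then show ?thesis by (meson mult_right_mono order_trans zero_le_power2)
  qed
  then show ?thesis by blast
qed

text \<open>The chain rule through a chart, for differentiating along a curve both \<open>F\<close>
  and the coordinate of another chart.\<close>

lemma comp_curve_has_vector_derivative:
  assumes c: "c \<in> atlas S" and t: "t \<in> J" "open J" and J: "\<And>s. s \<in> J \<Longrightarrow> \<gamma> s \<in> fst c"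
    and \<gamma>: "((snd c \<circ> \<gamma>) has_vector_derivative D) (at t)"
    and f: "((f \<circ> chart_inv c) has_field_derivative k) (at (snd c (\<gamma> t)))"
  shows "((f \<circ> \<gamma>) has_vector_derivative k * D) (at t)"
proof -
  have "(((f \<circ> chart_inv c) \<circ> (snd c \<circ> \<gamma>)) has_vector_derivative D * k) (at t)"
    using field_vector_diff_chain_at[OF \<gamma>, of "f \<circ> chart_inv c" k] f by simp
  then have "((f \<circ> \<gamma>) has_vector_derivative D * k) (at t)"
    by (rule has_vector_derivative_transform_within_open[OF _ t(2,1)])
      (use J chart_inv_left[OF c] in auto)
  then show ?thesis by (simp add: mult.commute)
qed

end

lemma vector_derivative_within_unit_interval:
  fixes f :: "real \<Rightarrow> complex"
  assumes "(f has_vector_derivative D) (at t)" "t \<in> {0..1}"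
  shows "vector_derivative f (at t within {0..1}) = D"
  using vector_derivative_within_closed_interval[of 0 1 t f D] has_vector_derivative_at_within[OF assms(1)] assms(2)
  by simp

section \<open>Lengths of lifted segments and convergence of sections\<close>

context complete_immersion
begin

lemma local_homeo: "local_homeomorphism (topo S) F"
  by (rule holomorphic_fun_local_homeomorphism[OF hol immersion])

sublocale F: local_homeomorphism "topo S" F
  by (rule local_homeo)

lemma metric: "riemannian_metric S h"
  using complete unfolding complete_riemannian_metric_def by blast

text \<open>The lift of a segment is mapped back to the segment by \<open>F\<close>, so dF takes the
  constant value \<open>w - u\<close> on its velocity. The bound on \<open>h\<close> then bounds the
  speed.\<close>

lemma section_segment:
  assumes \<sigma>: "F.sect (ball z R) \<sigma>" and u: "u \<in> ball z R" and w: "w \<in> ball z R"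
  shows "pw_curve S (\<sigma> \<circ> linepath u w)"
    and "curve_length S h (\<sigma> \<circ> linepath u w) \<le> ennreal (sqrt C * cmod (w - u))"
proof -
  let ?\<gamma> = "\<sigma> \<circ> linepath u w"
  have ball: "linepath u w t \<in> ball z R" if "t \<in> {0..1}" for t
    using that u w by (metis closed_segment_subset convex_ball linepath_in_path path_image_linepath subsetD)
  \<comment> \<open>The velocity of the lift in the chart \<open>c\<close>, by the derivative of a
    section.\<close>
  define D where "D c t = (w - u) * inverse (chart_deriv c F (?\<gamma> t))" for c t
  have der: "((snd c \<circ> ?\<gamma>) has_vector_derivative D c t) (at t)"
    if c: "c \<in> atlas S" and t: "t \<in> {0..1}" "?\<gamma> t \<in> fst c" for c t
  proof -
    have "\<sigma> (linepath u w t) \<in> fst c" using t(2) by simp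
    from section_has_derivative[OF hol immersion \<sigma> open_ball ball[OF t(1)] c this]
    have "((snd c \<circ> \<sigma>) has_field_derivative inverse (chart_deriv c F (?\<gamma> t))) (at (linepath u w t))"
      by simp
    moreover have "(linepath u w has_vector_derivative (w - u)) (at t)"
      by (rule has_vector_derivative_linepath_within)
    ultimately have "((snd c \<circ> \<sigma>) \<circ> linepath u w has_vector_derivative D c t) (at t)"
      unfolding D_def using field_vector_diff_chain_at by blast
    then show ?thesis by (simp add: comp_assoc)
  qed
  show "pw_curve S ?\<gamma>"
    unfolding pw_curve_def
  proof (intro conjI ballI allI impI)
    have "continuous_map (top_of_set {0..1}) (top_of_set (ball z R)) (linepath u w)"
      using ball by (auto simp: continuous_map_in_subtopology continuous_on_linepath)
    then show "pathin (topo S) ?\<gamma>"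
      unfolding pathin_def using \<sigma> continuous_map_compose unfolding local_section_def by blast
    fix c and a b :: real assume c: "c \<in> atlas S" and ab: "0 \<le> a \<and> a \<le> b \<and> b \<le> 1 \<and> ?\<gamma> ` {a..b} \<subseteq> fst c"
    have d: "((snd c \<circ> ?\<gamma>) has_vector_derivative D c t) (at t)" if "t \<in> {a..b}" for t
      using der[OF c, of t] ab that by (simp add: image_subset_iff)
    have cont: "continuous_on {a..b} (snd c \<circ> ?\<gamma>)"
      by (rule continuous_on_vector_derivative) (use d has_vector_derivative_at_within in blast)
    have "continuous_on {a..b} (\<lambda>t. deriv (F \<circ> chart_inv c) ((snd c \<circ> ?\<gamma>) t))"
      by (rule continuous_on_compose2[OF holomorphic_on_imp_continuous_on[OF
            holomorphic_in_chart(2)[OF hol c]] cont]) (use ab in auto)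
    then have "continuous_on {a..b} (\<lambda>t. chart_deriv c F (?\<gamma> t))"
      by (simp add: chart_deriv_def)
    then have "continuous_on {a..b} (D c)"
      unfolding D_def
      by (intro continuous_intros) (use immersion[OF c] ab in auto)
    then have "(snd c \<circ> ?\<gamma>) C1_differentiable_on {a..b}"
      unfolding C1_differentiable_on_def using d by blast
    then show "(snd c \<circ> ?\<gamma>) piecewise_C1_differentiable_on {a..b}"
      by (rule C1_differentiable_imp_piecewise)
  qed
  have speed: "speed S h ?\<gamma> t \<le> sqrt C * cmod (w - u)" if t: "t \<in> {0..1}" for t
  proof -
    define c where "c = (SOME c. c \<in> charts_at S (?\<gamma> t))"
    have "?\<gamma> t \<in> points S" using local_sectionD(2)[OF \<sigma> ball[OF t]] by simp
    from charts_at_nonempty[OF this] have "c \<in> charts_at S (?\<gamma> t)"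
      unfolding c_def by (rule someI_ex)
    then have c: "c \<in> atlas S" "?\<gamma> t \<in> fst c" using charts_atD by auto
    have v: "vector_derivative (snd c \<circ> ?\<gamma>) (at t within {0..1}) = D c t"
      by (rule vector_derivative_within_unit_interval[OF der[OF c(1) t c(2)] t])
    have "speed S h ?\<gamma> t = sqrt (h c (?\<gamma> t) (D c t) (D c t))"
      unfolding speed_def Let_def c_def[symmetric] v ..
    also have "\<dots> \<le> sqrt (C * (cmod (chart_deriv c F (?\<gamma> t) * D c t))\<^sup>2)"
      using bound[OF c] by (intro real_sqrt_le_mono) blast
    also have "chart_deriv c F (?\<gamma> t) * D c t = w - u"
      using immersion[OF c] by (simp add: D_def)
    finally show ?thesis by (simp only: real_sqrt_mult real_sqrt_abs abs_norm_cancel)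
  qed
  have "curve_length S h ?\<gamma> \<le> (\<integral>\<^sup>+t. ennreal (sqrt C * cmod (w - u)) * indicator {0..1::real} t \<partial>lborel)"
    unfolding curve_length_def
    by (intro nn_integral_mono) (auto simp: indicator_def intro!: ennreal_leI speed)
  also have "\<dots> = ennreal (sqrt C * cmod (w - u))"
    by (simp add: nn_integral_cmult_indicator)
  finally show "curve_length S h ?\<gamma> \<le> ennreal (sqrt C * cmod (w - u))" .
qed

lemma riem_dist_section:
  assumes \<sigma>: "F.sect (ball z R) \<sigma>" and u: "u \<in> ball z R" and w: "w \<in> ball z R"
  shows "riem_dist S h (\<sigma> u) (\<sigma> w) \<le> ennreal (sqrt C * cmod (w - u))"
  unfolding riem_dist_def
  using section_segment[OF assms]
  by (intro INF_lower2[of "\<sigma> \<circ> linepath u w"]) (auto simp: linepath_def)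

text \<open>A curve that enters a small disc of the flat metric has to cross its boundary.\<close>

lemma curve_length_lower_bound:
  assumes c0: "c0 \<in> atlas S" and \<sigma>: "F.sect (ball z R) \<sigma>" "\<sigma> ` ball z R \<subseteq> fst c0"
    and r: "0 < r" "r < R" and m: "m > 0"
    and low: "\<forall>q\<in>\<sigma> ` ball z R. \<forall>c\<in>charts_at S q. \<forall>v. m * (cmod (chart_deriv c F q * v))\<^sup>2 \<le> h c q v v"
    and \<gamma>: "pw_curve S \<gamma>" "\<gamma> 0 \<notin> \<sigma> ` ball z r" "\<gamma> 1 = \<sigma> z"
  shows "ennreal (sqrt m * r) \<le> curve_length S h \<gamma>"
proof -
  have path: "continuous_map (top_of_set {0..1}) (topo S) \<gamma>"
    using \<gamma>(1) unfolding pw_curve_def pathin_def by blast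
  have \<sigma>r: "F.sect (ball z r) \<sigma>" using \<sigma>(1) local_section_subset r(2) by (meson subset_ball less_imp_le)
  have B: "openin (topo S) (\<sigma> ` ball z r)" using F.section_open_image[OF \<sigma>r] by simp
  have "continuous_map (top_of_set (cball z r)) (topo S) \<sigma>"
    using local_section_subset[OF \<sigma>(1), of "cball z r"] r(2) unfolding local_section_def by force
  then have "compactin (topo S) (\<sigma> ` cball z r)"
    using image_compactin[of "top_of_set (cball z r)" "cball z r"] by (simp add: compactin_subtopology)
  then have Q: "closedin (topo S) (\<sigma> ` cball z r)"
    using compactin_imp_closedin Hausdorff_S by blast
  \<comment> \<open>The supremum of these times is the last moment at which the curve is outside the
    open disc. From then on it runs inside the closed disc up to its centre.\<close>
  define T where "T = {t \<in> {0..1}. \<gamma> t \<notin> \<sigma> ` ball z r}"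
  have "closedin (top_of_set {0..1}) {t \<in> topspace (top_of_set {0..1}). \<gamma> t \<in> points S - \<sigma> ` ball z r}"
    using closedin_continuous_map_preimage[OF path] B by blast
  moreover have "{t \<in> topspace (top_of_set {0..1}). \<gamma> t \<in> points S - \<sigma> ` ball z r} = T"
    unfolding T_def using path by (auto simp: continuous_map_def)
  ultimately have T: "closed T" using closedin_closed_trans by fastforce
  define t1 where "t1 = Sup T"
  have T0: "0 \<in> T" unfolding T_def using \<gamma>(2) by simp
  have bdd: "bdd_above T" unfolding T_def by (auto intro: bdd_above_mono[of "{0..1}"])
  have t1: "t1 \<in> T" unfolding t1_def using closed_contains_Sup T0 bdd T by blast
  have "\<sigma> z \<in> \<sigma> ` ball z r" using r(1) by simp
  then have "t1 \<noteq> 1" using t1 \<gamma>(3) unfolding T_def by auto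
  then have t1': "0 \<le> t1" "t1 < 1" using t1 unfolding T_def by auto
  have after: "\<gamma> t \<in> \<sigma> ` ball z r" if "t1 < t" "t \<le> 1" for t
  proof (rule ccontr)
    assume "\<gamma> t \<notin> \<sigma> ` ball z r"
    then have "t \<in> T" unfolding T_def using that t1' by simp
    then show False using cSup_upper[OF _ bdd] that(1) unfolding t1_def by fastforce
  qed
  \<comment> \<open>The closed disc is compact, hence closed in the surface. So the curve lies in it
    at the time \<open>t1\<close> too, as a limit of later times.\<close>
  define T' where "T' = {t \<in> {0..1}. \<gamma> t \<in> \<sigma> ` cball z r}"
  have "closedin (top_of_set {0..1}) {t \<in> topspace (top_of_set {0..1}). \<gamma> t \<in> \<sigma> ` cball z r}"
    using closedin_continuous_map_preimage[OF path Q] .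
  then have "closed T'"
    using closedin_closed_trans[of "{0..1}" T'] unfolding T'_def by simp
  moreover have "{t1<..1} \<subseteq> T'"
    unfolding T'_def using after t1' by fastforce
  ultimately have "closure {t1<..1} \<subseteq> T'" by (rule closure_minimal[rotated])
  then have T'sub: "{t1..1} \<subseteq> T'" using t1' by simp
  have in_disc: "\<gamma> t \<in> \<sigma> ` cball z r" if "t \<in> {t1..1}" for t
    using that T'sub unfolding T'_def by blast
  have in_disc': "\<gamma> t \<in> \<sigma> ` ball z R" "\<gamma> t \<in> fst c0" if "t \<in> {t1..1}" for t
  proof -
    have "cball z r \<subseteq> ball z R" using r(2) by auto
    then show "\<gamma> t \<in> \<sigma> ` ball z R" "\<gamma> t \<in> fst c0" using in_disc[OF that] \<sigma>(2) by blast+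
  qed
  obtain u where u: "u \<in> cball z r" "\<gamma> t1 = \<sigma> u" using in_disc[of t1] t1' by auto
  have "u \<notin> ball z r" using u(2) t1 unfolding T_def by auto
  then have ru: "dist z u = r" using u(1) by simp
  have "u \<in> ball z R" using ru r(2) by simp
  then have F0: "F (\<gamma> t1) = u" using local_sectionD(1)[OF \<sigma>(1)] u(2) by simp
  have F1: "F (\<gamma> 1) = z" using local_sectionD(1)[OF \<sigma>(1)] \<gamma>(3) r by simp
  \<comment> \<open>\<open>pw_curve\<close> gives piecewise smoothness only on parameter intervals
    that stay inside one chart. This is why the section is required to map into
    \<open>fst c0\<close>.\<close>
  have sub: "\<gamma> ` {t1..1} \<subseteq> fst c0" using in_disc' by blast
  have "(snd c0 \<circ> \<gamma>) piecewise_C1_differentiable_on {t1..1}"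
    using \<gamma>(1) c0 t1' sub unfolding pw_curve_def by (meson less_imp_le order_refl)
  then obtain E where E: "finite E" "(snd c0 \<circ> \<gamma>) C1_differentiable_on ({t1..1} - E)"
    and cont: "continuous_on {t1..1} (snd c0 \<circ> \<gamma>)"
    unfolding piecewise_C1_differentiable_on_def by blast
  obtain D where D: "\<And>t. t \<in> {t1..1} - E \<Longrightarrow> ((snd c0 \<circ> \<gamma>) has_vector_derivative D t) (at t)"
    and Dcont: "continuous_on ({t1..1} - E) D"
    using E(2) unfolding C1_differentiable_on_def by blast
  define A where "A = {t1<..<1} - E"
  define G where "G t = chart_deriv c0 F (\<gamma> t) * D t" for t
  have dcont: "continuous_on {t1..1} (\<lambda>t. deriv (F \<circ> chart_inv c0) ((snd c0 \<circ> \<gamma>) t))"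
    by (rule continuous_on_compose2[OF holomorphic_on_imp_continuous_on[OF
            holomorphic_in_chart(2)[OF hol c0]] cont]) (use sub in auto)
  have As: "A \<subseteq> {t1..1}" "A \<subseteq> {t1..1} - E" by (auto simp: A_def)
  have Gcont: "continuous_on A G"
    unfolding G_def chart_deriv_def
    using continuous_on_mult[OF continuous_on_subset[OF dcont As(1)] continuous_on_subset[OF Dcont As(2)]]
    by simp
  have in_c0: "\<gamma> s \<in> fst c0" if "s \<in> {t1<..<1}" for s
    using in_disc'(2)[of s] that by simp
  have DA: "((snd c0 \<circ> \<gamma>) has_vector_derivative D t) (at t)" if "t \<in> A" for t
    using D that by (auto simp: A_def)
  have FG: "((F \<circ> \<gamma>) has_vector_derivative G t) (at t)" if t: "t \<in> A" for t
  proof -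
    have t': "t \<in> {t1<..<1}" using t by (simp add: A_def)
    show ?thesis
      unfolding G_def
      by (rule comp_curve_has_vector_derivative[OF c0 t' _ in_c0 DA[OF t]
            holomorphic_has_chart_deriv[OF hol c0 in_c0[OF t']]]) auto
  qed
  have Fcont: "continuous_on {t1..1} (F \<circ> \<gamma>)"
  proof -
    have "continuous_map (top_of_set {t1..1}) (topo S) \<gamma>"
      using continuous_map_from_subtopology_mono[OF path] t1' by auto
    then have "continuous_map (top_of_set {t1..1}) euclidean (F \<circ> \<gamma>)"
      using F.cont continuous_map_compose by blast
    then show ?thesis by simp
  qed
  have speed: "sqrt m * cmod (G t) \<le> speed S h \<gamma> t" if t: "t \<in> A" for t
  proof -
    have t': "t \<in> {t1<..<1}" and t'': "t \<in> {t1..1}" using t by (simp_all add: A_def)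
    \<comment> \<open>The chart that \<open>speed\<close> chooses at this parameter may differ from
      \<open>c0\<close>. The chain rule through the transition map shows that dF takes the same
      value on the velocity in both.\<close>
    define c where "c = (SOME c. c \<in> charts_at S (\<gamma> t))"
    have "\<gamma> t \<in> points S" using in_c0[OF t'] chart_subset[OF c0] by blast
    from charts_at_nonempty[OF this] have cc: "c \<in> charts_at S (\<gamma> t)"
      unfolding c_def by (rule someI_ex)
    then have c: "c \<in> atlas S" "\<gamma> t \<in> fst c" using charts_atD by auto
    have "((snd c \<circ> \<gamma>) has_vector_derivative chart_deriv c0 (snd c) (\<gamma> t) * D t) (at t)"
      by (rule comp_curve_has_vector_derivative[OF c0 t' _ in_c0 DA[OF t]
            transition_has_derivative[OF c0 c(1) in_c0[OF t'] c(2)]]) auto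
    then have v: "vector_derivative (snd c \<circ> \<gamma>) (at t within {0..1}) = chart_deriv c0 (snd c) (\<gamma> t) * D t"
      by (rule vector_derivative_within_unit_interval) (use t' t1' in auto)
    have eq: "chart_deriv c F (\<gamma> t) * (chart_deriv c0 (snd c) (\<gamma> t) * D t) = G t"
      unfolding G_def using chart_deriv_change[OF hol c0 c(1) in_c0[OF t'] c(2)] by (simp add: mult.assoc)
    have "m * (cmod (chart_deriv c F (\<gamma> t) * (chart_deriv c0 (snd c) (\<gamma> t) * D t)))\<^sup>2 \<le>
        h c (\<gamma> t) (chart_deriv c0 (snd c) (\<gamma> t) * D t) (chart_deriv c0 (snd c) (\<gamma> t) * D t)"
      using low in_disc'(1)[OF t''] cc by blast
    from real_sqrt_le_mono[OF this]
    show ?thesis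
      unfolding speed_def Let_def c_def[symmetric] v eq using m by (simp add: real_sqrt_mult)
  qed
  \<comment> \<open>At the time \<open>t1\<close> the point \<open>F (\<gamma> t1)\<close> is on the
    circle of radius \<open>r\<close>, and at the end it is the centre.\<close>
  have "r = cmod (F (\<gamma> 1) - F (\<gamma> t1))" using ru F0 F1 by (simp add: dist_norm)
  then have "ennreal (sqrt m * r) = ennreal (sqrt m) * ennreal (cmod ((F \<circ> \<gamma>) 1 - (F \<circ> \<gamma>) t1))"
    using m by (simp add: ennreal_mult)
  also have "\<dots> \<le> ennreal (sqrt m) * (\<integral>\<^sup>+t\<in>A. ennreal (cmod (G t)) \<partial>lborel)"
    using norm_increment_le_nn_integral[OF _ E(1) Fcont, of G] FG Gcont t1' unfolding A_def
    by (intro mult_left_mono) auto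
  \<comment> \<open>The constant is moved inside while the integrand is still \<open>G\<close>,
    which is continuous on \<open>A\<close> and so measurable. The comparison with
    \<open>speed\<close>, which rests on a separate choice of chart at each parameter, is then made
    pointwise.\<close>
  also have "\<dots> = (\<integral>\<^sup>+t. ennreal (sqrt m) * (ennreal (cmod (G t)) * indicator A t) \<partial>lborel)"
  proof (rule nn_integral_cmult[symmetric])
    have A: "A \<in> sets borel"
      unfolding A_def using E(1) by (simp add: finite_imp_closed open_Diff)
    have "(\<lambda>t. indicator A t *\<^sub>R G t) \<in> borel_measurable borel"
      using borel_measurable_continuous_on_indicator[OF A Gcont] .
    then have "(\<lambda>t. ennreal (norm (indicator A t *\<^sub>R G t))) \<in> borel_measurable borel" by measurable
    moreover have "(\<lambda>t. ennreal (norm (indicator A t *\<^sub>R G t))) = (\<lambda>t. ennreal (cmod (G t)) * indicator A t)"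
      by (auto simp: fun_eq_iff indicator_def)
    ultimately have "(\<lambda>t. ennreal (cmod (G t)) * indicator A t) \<in> borel_measurable borel"
      by (simp only:)
    then show "(\<lambda>t. ennreal (cmod (G t)) * indicator A t) \<in> borel_measurable lborel" by simp
  qed
  also have "\<dots> \<le> curve_length S h \<gamma>"
    unfolding curve_length_def
  proof (intro nn_integral_mono)
    fix t :: real
    show "ennreal (sqrt m) * (ennreal (cmod (G t)) * indicator A t) \<le> ennreal (speed S h \<gamma> t) * indicator {0..1} t"
    proof (cases "t \<in> A")
      case True
      have "t \<in> {0..1}" using True t1' by (simp add: A_def)
      then show ?thesis
        using speed[OF True] True m by (simp add: ennreal_mult[symmetric] ennreal_leI)
    qed simp
  qed
  finally show ?thesis .
qed

text \<open>Within any neighbourhood of q there is a flat disc on which \<open>h\<close> dominates a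
  positive multiple of |dF|^2. A point outside it is at a distance from q that is bounded below,
  since every curve from there to q has to cross the disc.\<close>

lemma riem_dist_tendsto_imp_limitin:
  assumes q: "q \<in> points S" and lim: "(\<lambda>n. riem_dist S h (x n) q) \<longlonglongrightarrow> 0"
  shows "limitin (topo S) x q sequentially"
  unfolding limitin_def
proof (intro conjI allI impI)
  fix U assume U: "openin (topo S) U \<and> q \<in> U"
  have imm: "\<forall>c\<in>atlas S. \<forall>p\<in>fst c. chart_deriv c F p \<noteq> 0" using immersion by blast
  from metric_locally_comparable[OF metric hol imm q]
  obtain N m M where N: "openin (topo S) N" "q \<in> N" "0 < m"
    "\<forall>q\<in>N. \<forall>c\<in>charts_at S q. \<forall>v. m * (cmod (chart_deriv c F q * v))\<^sup>2 \<le> h c q v v \<and>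
         h c q v v \<le> M * (cmod (chart_deriv c F q * v))\<^sup>2"
    by (elim exE conjE)
  obtain c0 where c0: "c0 \<in> atlas S" "q \<in> fst c0" using charts_cover q by blast
  have W: "openin (topo S) (U \<inter> N \<inter> fst c0)" "q \<in> U \<inter> N \<inter> fst c0"
    using U N(1,2) c0(2) chart_open[OF c0(1)] by auto
  from F.local_section_exists[OF q W]
  obtain R \<sigma> where R: "R > 0" and \<sigma>: "F.sect (ball (F q) R) \<sigma>" "\<sigma> (F q) = q"
    "\<sigma> ` ball (F q) R \<subseteq> U \<inter> N \<inter> fst c0" by (elim exE conjE)
  have sub: "\<sigma> ` ball (F q) R \<subseteq> fst c0" "\<sigma> ` ball (F q) R \<subseteq> N" using \<sigma>(3) by auto
  have low: "\<forall>q\<in>\<sigma> ` ball (F q) R. \<forall>c\<in>charts_at S q. \<forall>v. m * (cmod (chart_deriv c F q * v))\<^sup>2 \<le> h c q v v"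
    using N(4) sub(2) by (meson subsetD)
  \<comment> \<open>Half the radius, so that the closed disc still lies in the domain of the
    section.\<close>
  have r: "0 < R / 2" "R / 2 < R" using R by auto
  have "ennreal (sqrt m * (R / 2)) \<le> riem_dist S h p q" if "p \<notin> \<sigma> ` ball (F q) (R / 2)" for p
    unfolding riem_dist_def
  proof (rule INF_greatest)
    fix \<gamma> assume "\<gamma> \<in> {\<gamma>. pw_curve S \<gamma> \<and> \<gamma> 0 = p \<and> \<gamma> 1 = q}"
    then show "ennreal (sqrt m * (R / 2)) \<le> curve_length S h \<gamma>"
      using curve_length_lower_bound[OF c0(1) \<sigma>(1) sub(1) r N(3) low, of \<gamma>] that \<sigma>(2) by auto
  qed
  moreover have "\<forall>\<^sub>F n in sequentially. riem_dist S h (x n) q < ennreal (sqrt m * (R / 2))"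
    using order_tendstoD(2)[OF lim] N(3) R by simp
  then have "\<forall>\<^sub>F n in sequentially. x n \<in> \<sigma> ` ball (F q) (R / 2)"
    by (rule eventually_mono) (use calculation not_less in blast)
  then show "\<forall>\<^sub>F n in sequentially. x n \<in> U"
    by (rule eventually_mono) (use \<sigma>(3) r in fastforce)
qed (use q in simp)

text \<open>The length of lifted segments makes the image of a convergent sequence Cauchy for the
  Riemannian distance. Completeness gives a limit for the distance, which is a limit in the topology
  by the crossing estimate.\<close>

lemma section_limit:
  assumes \<sigma>: "F.sect (ball z R) \<sigma>" and u: "\<And>n. u n \<in> ball z R" and conv: "u \<longlonglongrightarrow> w"
  shows "\<exists>q. limitin (topo S) (\<lambda>n. \<sigma> (u n)) q sequentially"
proof -
  have "range (\<lambda>n. \<sigma> (u n)) \<subseteq> points S" using local_sectionD(2)[OF \<sigma> u] by blast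
  moreover have "\<exists>N. \<forall>m\<ge>N. \<forall>n\<ge>N. riem_dist S h (\<sigma> (u m)) (\<sigma> (u n)) < e" if e: "e > 0" for e :: ennreal
  proof -
    obtain e' where e': "0 < e'" "e' < e" using dense[OF e] by blast
    then have fin: "e' < \<infinity>" by (metis infinity_ennreal_def less_top_ennreal order_less_trans top.not_eq_extremum top_neq_ennreal)
    \<comment> \<open>The divisor is positive and at least \<open>sqrt C\<close>, whatever the sign
      of \<open>C\<close>.\<close>
    define d where "d = enn2real e' / (1 + sqrt \<bar>C\<bar>)"
    have "0 < enn2real e'" using e' fin by (simp add: enn2real_positive_iff)
    moreover have s: "0 < 1 + sqrt \<bar>C\<bar>" by (smt (verit) real_sqrt_ge_zero)
    ultimately have d: "d > 0" unfolding d_def by simp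
    have "Cauchy u" using conv by (simp add: LIMSEQ_imp_Cauchy)
    then obtain N where N: "\<And>m n. m \<ge> N \<Longrightarrow> n \<ge> N \<Longrightarrow> dist (u m) (u n) < d"
      using d unfolding Cauchy_def by blast
    have "riem_dist S h (\<sigma> (u m)) (\<sigma> (u n)) < e" if "m \<ge> N" "n \<ge> N" for m n
    proof -
      have "sqrt C \<le> 1 + sqrt \<bar>C\<bar>" by (smt (verit) real_sqrt_le_mono)
      then have "sqrt C * cmod (u n - u m) \<le> (1 + sqrt \<bar>C\<bar>) * d"
        using N[OF that] s d by (intro mult_mono) (auto simp: dist_norm norm_minus_commute)
      also have "\<dots> = enn2real e'" using s by (simp add: d_def)
      finally have "ennreal (sqrt C * cmod (u n - u m)) \<le> ennreal (enn2real e')" by (rule ennreal_leI)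
      also have "\<dots> = e'" using fin by simp
      finally show ?thesis
        using riem_dist_section[OF \<sigma> u u, of m n] e'(2) by (meson order_le_less_trans)
    qed
    then show ?thesis by blast
  qed
  ultimately obtain q where "q \<in> points S" "(\<lambda>n. riem_dist S h (\<sigma> (u n)) q) \<longlonglongrightarrow> 0"
    using complete unfolding complete_riemannian_metric_def by blast
  then show ?thesis using riem_dist_tendsto_imp_limitin[of q "\<lambda>n. \<sigma> (u n)"] by blast
qed

sublocale F: complete_local_homeomorphism "topo S" F
  by unfold_locales (use connected_S section_limit in blast)+

end

section \<open>The elliptic paraboloid\<close>

text \<open>The inverse of the coordinate 1/z, which is a global chart of the sphere without 0; the
  origin of the plane corresponds to infinity.\<close>

definition paraboloid_param :: "complex \<Rightarrow> complex option" where
  "paraboloid_param w = (if w = 0 then None else Some (1 / w))"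

lemma paraboloid_surface_simps:
  "points paraboloid_surface = - {Some 0}"
  "topo paraboloid_surface = subtopology (Alexandroff_compactification euclidean) (- {Some 0})"
  "atlas paraboloid_surface = {(range Some \<inter> - {Some 0}, the), (- {Some 0}, paraboloid_F)}"
proof -
  have "(\<lambda>p. case p of None \<Rightarrow> 0 | Some z \<Rightarrow> 1 / z) = paraboloid_F"
    by (simp add: paraboloid_F_def fun_eq_iff)
  then show "atlas paraboloid_surface = {(range Some \<inter> - {Some 0}, the), (- {Some 0}, paraboloid_F)}"
    by (simp add: paraboloid_surface_def open_subsurface_def riemann_sphere_def)
  show "topo paraboloid_surface = subtopology (Alexandroff_compactification euclidean) (- {Some 0})"
    by (simp add: paraboloid_surface_def open_subsurface_def riemann_sphere_def)
  then show "points paraboloid_surface = - {Some 0}"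
    using notin_range_Some by (auto simp flip: UNIV_option_conv)
qed

lemma paraboloid_F_simps [simp]: "paraboloid_F None = 0" "paraboloid_F (Some z) = 1 / z"
  by (simp_all add: paraboloid_F_def)

lemma paraboloid_param_simps:
  "paraboloid_F (paraboloid_param w) = w"
  "p \<noteq> Some 0 \<Longrightarrow> paraboloid_param (paraboloid_F p) = p"
  "paraboloid_param w \<noteq> Some 0"
  by (auto simp: paraboloid_param_def paraboloid_F_def split: option.splits)

lemma chart_inv_paraboloid:
  "chart_inv (- {Some 0}, paraboloid_F) w = paraboloid_param w"
  "z \<noteq> 0 \<Longrightarrow> chart_inv (range Some \<inter> - {Some 0}, the) z = Some z"
  unfolding chart_inv_def
  by (rule inv_into_f_eq; auto simp: paraboloid_param_simps inj_on_def; metis paraboloid_param_simps(2))+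

lemma continuous_paraboloid_param:
  "continuous_map euclidean (topo paraboloid_surface) paraboloid_param"
  unfolding paraboloid_surface_simps continuous_map_in_subtopology
proof
  show "paraboloid_param \<in> topspace euclidean \<rightarrow> - {Some 0}"
    using paraboloid_param_simps(3) by auto
  have inv: "continuous_on (- {0}) (\<lambda>w::complex. 1 / w)"
    by (intro continuous_intros) auto
  show "continuous_map euclidean (Alexandroff_compactification euclidean) paraboloid_param"
    unfolding continuous_map_def
  proof (intro conjI allI impI)
    show "paraboloid_param \<in> topspace euclidean \<rightarrow> topspace (Alexandroff_compactification euclidean)"
      by (auto simp: paraboloid_param_def)
    fix U :: "complex option set" assume "openin (Alexandroff_compactification euclidean) U"
    then consider V where "open V" "U = Some ` V"
      | C where "compact C" "U = insert None (Some ` (- C))"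
      unfolding openin_Alexandroff_compactification by (auto simp: Compl_eq_Diff_UNIV)
    then have "open {w. paraboloid_param w \<in> U}"
    proof cases
      case 1
      have "{w. paraboloid_param w \<in> U} = - {0} \<inter> (\<lambda>w. 1 / w) -` V"
        using 1(2) by (auto simp: paraboloid_param_def)
      then show ?thesis
        using continuous_open_preimage[OF inv _ 1(1)] by auto
    next
      case 2
      \<comment> \<open>Here \<open>U\<close> is a neighbourhood of infinity. The compact set
        \<open>C\<close> lies in the disc of radius \<open>B\<close>, so 1/w avoids it when |w| <
        1/B.\<close>
      obtain B where B: "B > 0" "\<And>z. z \<in> C \<Longrightarrow> cmod z < B"
        using compact_imp_bounded[OF 2(1)] bounded_pos_less by metis
      have "{w. paraboloid_param w \<in> U} = ball 0 (1 / B) \<union> (- {0} \<inter> (\<lambda>w. 1 / w) -` (- C))"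
      proof (intro equalityI subsetI)
        fix w assume "w \<in> {w. paraboloid_param w \<in> U}"
        then show "w \<in> ball 0 (1 / B) \<union> (- {0} \<inter> (\<lambda>w. 1 / w) -` (- C))"
          using 2(2) B(1) by (cases "w = 0") (auto simp: paraboloid_param_def)
      next
        fix w assume w: "w \<in> ball 0 (1 / B) \<union> (- {0} \<inter> (\<lambda>w. 1 / w) -` (- C))"
        have "1 / w \<notin> C" if "w \<noteq> 0"
        proof
          assume "1 / w \<in> C"
          then have "1 / cmod w < B" using B(2) by (fastforce simp: norm_divide)
          then have "cmod w > 1 / B" using that B(1) by (simp add: field_simps)
          then show False using w \<open>1 / w \<in> C\<close> by auto
        qed
        then show "w \<in> {w. paraboloid_param w \<in> U}"
          using 2(2) by (auto simp: paraboloid_param_def)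
      qed
      moreover have "open (- {0} \<inter> (\<lambda>w. 1 / w) -` (- C))"
        using continuous_open_preimage[OF inv] compact_imp_closed[OF 2(1)] by auto
      ultimately show ?thesis by auto
    qed
    then show "openin euclidean {w \<in> topspace euclidean. paraboloid_param w \<in> U}" by simp
  qed
qed

lemma continuous_paraboloid_F:
  "continuous_map (topo paraboloid_surface) euclidean paraboloid_F"
  unfolding continuous_map_def
proof (intro conjI allI impI)
  fix V :: "complex set" assume "openin euclidean V"
  then have V: "open V" by simp
  have inv: "continuous_on (- {0}) (\<lambda>w::complex. 1 / w)"
    by (intro continuous_intros) auto
  define P where "P = - {0} \<inter> (\<lambda>w. 1 / w) -` V"
  have P: "open P" unfolding P_def using continuous_open_preimage[OF inv _ V] by auto
  have "\<exists>U. openin (Alexandroff_compactification euclidean) U \<and>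
    {p \<in> points paraboloid_surface. paraboloid_F p \<in> V} = U \<inter> - {Some 0}"
  proof (cases "0 \<in> V")
    case False
    have "{p \<in> points paraboloid_surface. paraboloid_F p \<in> V} = Some ` P \<inter> - {Some 0}"
    proof (rule set_eqI)
      fix p show "p \<in> {p \<in> points paraboloid_surface. paraboloid_F p \<in> V} \<longleftrightarrow> p \<in> Some ` P \<inter> - {Some 0}"
        using False by (cases p) (auto simp: paraboloid_surface_simps P_def)
    qed
    then show ?thesis using P by (intro exI[of _ "Some ` P"]) simp
  next
    case True
    obtain e where e: "e > 0" "ball 0 e \<subseteq> V" using openE[OF V True] .
    \<comment> \<open>Outside the disc of radius 1/e the value 1/w is in \<open>ball 0 e\<close>,
      hence in \<open>V\<close>. So the complement of \<open>P\<close> is bounded, and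
      \<open>P\<close> with infinity added is open in the compactification.\<close>
    have "- P \<subseteq> cball 0 (1 / e)"
    proof
      fix w assume w: "w \<in> - P"
      show "w \<in> cball 0 (1 / e)"
      proof (rule ccontr)
        assume "w \<notin> cball 0 (1 / e)"
        then have c: "cmod w > 1 / e" by simp
        then have c0: "cmod w > 0" using e(1) by (meson less_trans zero_less_divide_1_iff)
        then have "1 / cmod w < e" using c e(1) by (simp add: field_simps)
        then have "1 / w \<in> ball 0 e" by (simp add: norm_divide)
        then show False using w c0 e(2) unfolding P_def by auto
      qed
    qed
    then have "compact (- P)"
      using P bounded_subset[OF bounded_cball] by (simp add: compact_eq_bounded_closed closed_Compl)
    then have "openin (Alexandroff_compactification euclidean) (insert None (Some ` (UNIV - - P)))"
      unfolding openin_Alexandroff_compactification using P by (intro disjI2 exI[of _ "- P"]) auto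
    moreover have "{p \<in> points paraboloid_surface. paraboloid_F p \<in> V} = insert None (Some ` (UNIV - - P)) \<inter> - {Some 0}"
    proof (rule set_eqI)
      fix p show "p \<in> {p \<in> points paraboloid_surface. paraboloid_F p \<in> V} \<longleftrightarrow>
          p \<in> insert None (Some ` (UNIV - - P)) \<inter> - {Some 0}"
        using True by (cases p) (auto simp: paraboloid_surface_simps P_def)
    qed
    ultimately show ?thesis by blast
  qed
  then show "openin (topo paraboloid_surface) {p \<in> points paraboloid_surface. paraboloid_F p \<in> V}"
    unfolding paraboloid_surface_simps openin_subtopology by blast
qed simp

section \<open>The biholomorphism onto the sphere without 0\<close>

context complete_immersion
begin

text \<open>In the global chart \<open>paraboloid_F\<close> the map reads as \<open>F\<close> and
  its inverse as the global section, both holomorphic. In the other chart of the sphere, 1/z is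
  composed with these.\<close>

lemma biholomorphism_paraboloid:
  "biholomorphism S paraboloid_surface (paraboloid_param \<circ> F)"
proof -
  let ?f = "paraboloid_param \<circ> F" and ?g = "inv_into (points S) (paraboloid_param \<circ> F)"
  obtain \<sigma> where \<sigma>: "F.sect UNIV \<sigma>" "\<And>p. p \<in> points S \<Longrightarrow> \<sigma> (F p) = p"
    using F.section_inverse[OF points_nonempty] by metis
  have F\<sigma>: "F (\<sigma> w) = w" "\<sigma> w \<in> points S" for w
    using local_sectionD[OF \<sigma>(1)] by auto
  have inj: "inj_on ?f (points S)"
    by (rule inj_on_inverseI[of _ "\<sigma> \<circ> paraboloid_F"]) (simp add: paraboloid_param_simps \<sigma>(2))
  have img: "?f ` points S = points paraboloid_surface"
  proof (intro equalityI subsetI)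
    fix p assume "p \<in> ?f ` points S"
    then show "p \<in> points paraboloid_surface"
      by (auto simp: paraboloid_surface_simps paraboloid_param_simps)
  next
    fix p assume "p \<in> points paraboloid_surface"
    then have "p \<noteq> Some 0" by (simp add: paraboloid_surface_simps(1))
    then have "?f (\<sigma> (paraboloid_F p)) = p"
      by (simp add: F\<sigma> paraboloid_param_simps)
    then show "p \<in> ?f ` points S" using F\<sigma>(2) by (metis imageI)
  qed
  have g: "?g p = \<sigma> (paraboloid_F p)" if "p \<noteq> Some 0" for p
    by (rule inv_into_f_eq[OF inj F\<sigma>(2)]) (simp add: F\<sigma> paraboloid_param_simps that)
  have hol_\<sigma>: "(snd c \<circ> \<sigma>) holomorphic_on {w. \<sigma> w \<in> fst c}" if c: "c \<in> atlas S" for c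
    unfolding holomorphic_on_def field_differentiable_def
    using section_has_derivative[OF hol immersion \<sigma>(1) open_UNIV UNIV_I c]
    by (auto intro: has_field_derivative_at_within)
  have "holomorphic_map S paraboloid_surface ?f"
    unfolding holomorphic_map_def
  proof (intro conjI ballI)
    show "continuous_map (topo S) (topo paraboloid_surface) ?f"
      using continuous_map_compose[OF F.cont continuous_paraboloid_param] .
    fix c c' assume c: "c \<in> atlas S" and c': "c' \<in> atlas paraboloid_surface"
    let ?D = "snd c ` {p \<in> fst c. ?f p \<in> fst c'}"
    have "F \<circ> chart_inv c holomorphic_on snd c ` fst c"
      by (rule holomorphic_in_chart(1)[OF hol c])
    then have F: "F \<circ> chart_inv c holomorphic_on ?D"
      by (rule holomorphic_on_subset) blast
    from c' consider "c' = (range Some \<inter> - {Some 0}, the)" | "c' = (- {Some 0}, paraboloid_F)"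
      unfolding paraboloid_surface_simps by blast
    then show "(snd c' \<circ> ?f \<circ> chart_inv c) holomorphic_on ?D"
    proof cases
      case 1
      have nz: "(F \<circ> chart_inv c) z \<noteq> 0" if "z \<in> ?D" for z
        using that chart_inv_left[OF c] by (auto simp: 1 paraboloid_param_def split: if_splits)
      have "(\<lambda>z. 1 / (F \<circ> chart_inv c) z) holomorphic_on ?D"
        by (intro holomorphic_intros F nz)
      then show ?thesis
        by (rule holomorphic_transform) (use nz in \<open>auto simp: 1 paraboloid_param_def\<close>)
    next
      case 2
      show ?thesis
        by (rule holomorphic_transform[OF F]) (simp add: 2 paraboloid_param_simps)
    qed
  qed
  moreover have "holomorphic_map paraboloid_surface S ?g"
    unfolding holomorphic_map_def
  proof (intro conjI ballI)
    have "continuous_map euclidean (topo S) \<sigma>"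
      using \<sigma>(1) unfolding local_section_def by simp
    from continuous_map_compose[OF continuous_paraboloid_F this]
    show "continuous_map (topo paraboloid_surface) (topo S) ?g"
      by (rule continuous_map_eq) (simp add: g paraboloid_surface_simps(1))
    fix c c' assume c: "c \<in> atlas paraboloid_surface" and c': "c' \<in> atlas S"
    from c consider "c = (range Some \<inter> - {Some 0}, the)" | "c = (- {Some 0}, paraboloid_F)"
      unfolding paraboloid_surface_simps by blast
    then show "(snd c' \<circ> ?g \<circ> chart_inv c) holomorphic_on snd c ` {p \<in> fst c. ?g p \<in> fst c'}"
    proof cases
      case 1
      let ?D = "{z. z \<noteq> 0 \<and> \<sigma> (1 / z) \<in> fst c'}"
      have D: "snd c ` {p \<in> fst c. ?g p \<in> fst c'} \<subseteq> ?D"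
        by (auto simp: 1 g simp del: o_apply)
      have "(snd c' \<circ> \<sigma>) \<circ> (\<lambda>z. 1 / z) holomorphic_on ?D"
        by (rule holomorphic_on_compose_gen[OF _ hol_\<sigma>[OF c']]) (auto intro!: holomorphic_intros)
      then have "(snd c' \<circ> ?g \<circ> chart_inv c) holomorphic_on ?D"
        by (rule holomorphic_transform) (simp add: 1 chart_inv_paraboloid g)
      then show ?thesis using D holomorphic_on_subset by blast
    next
      case 2
      have "(snd c' \<circ> ?g \<circ> chart_inv c) holomorphic_on {w. \<sigma> w \<in> fst c'}"
        by (rule holomorphic_transform[OF hol_\<sigma>[OF c']])
          (simp only: 2 chart_inv_paraboloid o_apply[of "snd c' \<circ> ?g"] o_apply[of "snd c'"]
            g[OF paraboloid_param_simps(3)] paraboloid_param_simps(1))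
      then show ?thesis
        by (rule holomorphic_on_subset) (auto simp: 2 g simp del: o_apply)
    qed
  qed
  ultimately show ?thesis
    unfolding biholomorphism_def bij_betw_def using inj img by blast
qed

end

section \<open>Complete fronts with proportional differentials\<close>

lemma cmod_add_cnj_squared:
  "(cmod (x + cnj y))\<^sup>2 = Re (x * cnj x) + Re (y * cnj y) + Re (x * y + x * y)"
  unfolding cmod_power2 by (simp add: power2_eq_square algebra_simps)

context connected_riemann_surface
begin

text \<open>Stated for an ordered pair in which the first function is the immersion, so that it
  serves both the given order of \<open>F\<close> and \<open>G\<close> and the exchanged
  one.\<close>

lemma complete_front_proportional:
  assumes F: "holomorphic_fun S F" and G: "holomorphic_fun S G"
    and imm: "\<And>c p. c \<in> atlas S \<Longrightarrow> p \<in> fst c \<Longrightarrow> chart_deriv c F p \<noteq> 0"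
    and ratio: "\<And>c p. c \<in> atlas S \<Longrightarrow> p \<in> fst c \<Longrightarrow> chart_deriv c G p = b * chart_deriv c F p"
    and complete: "complete_front S F G"
  shows "cmod b \<noteq> 1"
    and "\<exists>f \<nu>. biholomorphism S paraboloid_surface f \<and>
      (\<forall>p\<in>points S. paraboloid_F (f p) = F p \<and> paraboloid_G b (f p) = G p + \<nu>)"
proof -
  obtain T where T: "sym_bilinear_form S T" "compactin (topo S) (form_support S T)"
    and h: "complete_riemannian_metric S (form_add T (flat_form F G))"
    using complete unfolding complete_front_def by blast
  let ?h = "form_add T (flat_form F G)"
  have metric: "riemannian_metric S ?h" using h unfolding complete_riemannian_metric_def by blast
  \<comment> \<open>In general ds^2 = |dF + cnj dG|^2, and here dG = b dF.\<close>
  have flat: "flat_form F G c p v v = (cmod (chart_deriv c F p * v + cnj (b * (chart_deriv c F p * v))))\<^sup>2"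
    if "c \<in> atlas S" "p \<in> fst c" for c p v
    unfolding flat_form_def Let_def ratio[OF that] mult.assoc cmod_add_cnj_squared ..
  have T0: "T c p v w = 0" if "c \<in> atlas S" "p \<in> fst c" "p \<notin> form_support S T" for c p v w
  proof (rule ccontr)
    assume "T c p v w \<noteq> 0"
    moreover have "p \<in> points S" "c \<in> charts_at S p"
      using that(1,2) chart_subset[OF that(1)] by (auto simp: charts_at_def)
    ultimately have "p \<in> {p \<in> points S. \<exists>c\<in>charts_at S p. \<exists>v w. T c p v w \<noteq> 0}" by blast
    then have "p \<in> form_support S T"
      unfolding form_support_def by (rule subsetD[OF closure_of_subset, rotated]) blast
    then show False using that(3) by blast
  qed
  have hflat: "?h c p v v = (cmod (chart_deriv c F p * v + cnj (b * (chart_deriv c F p * v))))\<^sup>2"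
    if "c \<in> atlas S" "p \<in> fst c" "p \<notin> form_support S T" for c p v
    unfolding form_add_def using T0[OF that] flat[OF that(1,2)] by simp
  interpret L: local_homeomorphism "topo S" F
    by (rule holomorphic_fun_local_homeomorphism[OF F imm])
  show "cmod b \<noteq> 1"
  proof
    assume b: "cmod b = 1"
    \<comment> \<open>A square root of - cnj b has modulus 1 and satisfies s + cnj (b s) = s - s^2
      cnj s = 0. So the flat form vanishes on the tangent vector that dF maps to
      \<open>s\<close>.\<close>
    define s where "s = csqrt (- cnj b)"
    have s2: "s\<^sup>2 = - cnj b" unfolding s_def by simp
    have "(cmod s)\<^sup>2 = 1" using arg_cong[OF s2, of cmod] b by (simp add: norm_power)
    then have s1: "s * cnj s = 1" using complex_norm_square[of s] by simp
    have "s + cnj (b * s) = s - s\<^sup>2 * cnj s" using s2 by simp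
    also have "\<dots> = s - s * (s * cnj s)" by (simp add: power2_eq_square mult.assoc)
    finally have s0: "s + cnj (b * s) = 0" unfolding s1 by simp
    have "p \<in> form_support S T" if p: "p \<in> points S" for p
    proof (rule ccontr)
      assume np: "p \<notin> form_support S T"
      obtain c where c: "c \<in> atlas S" "p \<in> fst c" using charts_cover p by blast
      define v where "v = s / chart_deriv c F p"
      have dv: "chart_deriv c F p * v = s" unfolding v_def using imm[OF c] by simp
      have "v \<noteq> 0" using s1 dv by auto
      then have "?h c p v v > 0" using metric c unfolding riemannian_metric_def by blast
      then show False unfolding hflat[OF c np] dv s0 by simp
    qed
    then have "form_support S T = points S"
      unfolding form_support_def using closure_of_subset_topspace[of "topo S"] by blast
    then have "compact (F ` points S)"
      using image_compactin[OF T(2) L.cont] by simp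
    moreover have "open (F ` points S)" using L.open_image[OF openin_topspace] .
    ultimately show False using compact_open[of "F ` points S"] points_nonempty by simp
  qed
  \<comment> \<open>The triangle inequality for |x + cnj (b x)| gives the factor 1 + |b|.\<close>
  have bnd: "?h c p v v \<le> (1 + cmod b)\<^sup>2 * (cmod (chart_deriv c F p * v))\<^sup>2"
    if "c \<in> atlas S" "p \<in> fst c" "p \<notin> form_support S T" for c p v
  proof -
    let ?x = "chart_deriv c F p * v"
    have "cmod (?x + cnj (b * ?x)) \<le> cmod ?x + cmod b * cmod ?x"
      by (metis complex_mod_cnj norm_mult norm_triangle_ineq)
    then have "cmod (?x + cnj (b * ?x)) \<le> (1 + cmod b) * cmod ?x" by (simp add: algebra_simps)
    then have "(cmod (?x + cnj (b * ?x)))\<^sup>2 \<le> ((1 + cmod b) * cmod ?x)\<^sup>2"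
      by (rule power_mono) simp
    then show ?thesis unfolding hflat[OF that] power_mult_distrib .
  qed
  have imm': "\<forall>c\<in>atlas S. \<forall>p\<in>fst c. chart_deriv c F p \<noteq> 0" using imm by blast
  obtain C where C: "\<forall>c\<in>atlas S. \<forall>p\<in>fst c. \<forall>v. ?h c p v v \<le> C * (cmod (chart_deriv c F p * v))\<^sup>2"
    using metric_bounded_outside_compact[OF metric F imm' T(2), of "(1 + cmod b)\<^sup>2"] bnd by blast
  interpret I: complete_immersion S F ?h C
    by unfold_locales (use F imm h C in blast)+
  \<comment> \<open>The primitive of dG - b dF = 0: it is constant, and its value is the translation
    to be subtracted from \<open>G\<close>.\<close>
  let ?H = "\<lambda>p. G p - b * F p"
  have Hd: "((?H \<circ> chart_inv c) has_field_derivative chart_deriv c G p - b * chart_deriv c F p) (at (snd c p))"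
    if "c \<in> atlas S" "p \<in> fst c" for c p
    using DERIV_diff[OF holomorphic_has_chart_deriv[OF G that]
        DERIV_cmult[OF holomorphic_has_chart_deriv[OF F that], of b]]
    by (simp add: o_def)
  have H: "holomorphic_fun S ?H"
    unfolding holomorphic_fun_def
  proof
    fix c assume c: "c \<in> atlas S"
    have "(\<lambda>z. (G \<circ> chart_inv c) z - b * (F \<circ> chart_inv c) z) holomorphic_on snd c ` fst c"
      by (intro holomorphic_intros holomorphic_in_chart(1)[OF F c] holomorphic_in_chart(1)[OF G c])
    then show "(?H \<circ> chart_inv c) holomorphic_on snd c ` fst c" by (simp add: o_def)
  qed
  have H0: "chart_deriv c ?H p = 0" if "c \<in> atlas S" "p \<in> fst c" for c p
    using DERIV_imp_deriv[OF Hd[OF that]] ratio[OF that] unfolding chart_deriv_def by simp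
  obtain p0 where p0: "p0 \<in> points S" using points_nonempty by blast
  have "G p = b * F p + ?H p0" if "p \<in> points S" for p
    using chart_deriv_zero_imp_constant[OF H H0 that p0] by (simp add: algebra_simps)
  moreover have "paraboloid_G b q = b * paraboloid_F q" for q
    by (cases q) (simp_all add: paraboloid_G_def)
  ultimately have "\<forall>p\<in>points S. paraboloid_F ((paraboloid_param \<circ> F) p) = F p \<and>
      paraboloid_G b ((paraboloid_param \<circ> F) p) = G p + - ?H p0"
    by (simp add: paraboloid_param_simps)
  then show "\<exists>f \<nu>. biholomorphism S paraboloid_surface f \<and>
      (\<forall>p\<in>points S. paraboloid_F (f p) = F p \<and> paraboloid_G b (f p) = G p + \<nu>)"
    using I.biholomorphism_paraboloid by blast
qed

end

text \<open>The flat form is symmetric in \<open>F\<close> and \<open>G\<close>.\<close>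

lemma complete_front_commute: "complete_front S F G \<longleftrightarrow> complete_front S G F"
proof -
  have "flat_form F G = flat_form G F"
    by (simp add: flat_form_def Let_def fun_eq_iff algebra_simps)
  then show ?thesis unfolding complete_front_def by simp
qed

theorem theorem4p2:
  fixes S :: "'a surface" and F G :: "'a \<Rightarrow> complex" and \<psi> :: "'a \<Rightarrow> complex \<times> real"
  assumes "improper_affine_front S F G \<psi>"
    and "complete_front S F G"
    and "has_total_curvature S F G 0"
  shows "\<exists>b. cmod b \<noteq> 1 \<and>
           equivalent_data S F G paraboloid_surface paraboloid_F (paraboloid_G b)"
proof -
  have wd: "weierstrass_data S F G"
    using assms(1) unfolding improper_affine_front_def by blast
  then have F: "holomorphic_fun S F" and G: "holomorphic_fun S G"
    and imm: "\<And>c p. c \<in> atlas S \<Longrightarrow> p \<in> fst c \<Longrightarrow> (chart_deriv c F p, chart_deriv c G p) \<noteq> (0, 0)"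
    unfolding weierstrass_data_def by blast+
  interpret connected_riemann_surface S
    by unfold_locales (use wd in \<open>simp add: weierstrass_data_def\<close>)
  obtain a b where ab: "(a, b) \<noteq> (0, 0)"
    and ratio: "\<And>c p. c \<in> atlas S \<Longrightarrow> p \<in> fst c \<Longrightarrow> b * chart_deriv c F p = a * chart_deriv c G p"
  proof (rule zero_wronskian_imp_proportional[OF F G])
    show "chart_wronskian c F G z = 0" if "c \<in> atlas S" "z \<in> snd c ` fst c" for c z
      using total_curvature_zero_imp_wronskian_zero[OF F G imm assms(3) that] .
    show "(chart_deriv c F p, chart_deriv c G p) \<noteq> (0, 0)" if "c \<in> atlas S" "p \<in> fst c" for c p
      using imm[OF that] .
  qed (rule that)
  show ?thesis
  \<comment> \<open>The relation b dF = a dG can be solved for dG unless a = 0. In that case b is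
    nonzero and dF vanishes identically, so \<open>G\<close> is the immersion.\<close>
  proof (cases "a = 0")
    case False
    have ratio': "chart_deriv c G p = (b / a) * chart_deriv c F p" if "c \<in> atlas S" "p \<in> fst c" for c p
      using ratio[OF that] False by (simp add: field_simps)
    have immF: "chart_deriv c F p \<noteq> 0" if "c \<in> atlas S" "p \<in> fst c" for c p
      using imm[OF that] ratio'[OF that] by auto
    note front = complete_front_proportional[OF F G immF ratio' assms(2)]
    then obtain f \<nu> where f: "biholomorphism S paraboloid_surface f"
      "\<forall>p\<in>points S. paraboloid_F (f p) = F p \<and> paraboloid_G (b / a) (f p) = G p + \<nu>" by blast
    \<comment> \<open>The linear part of the equiaffine change is the identity; only a translation
      of \<open>G\<close> remains.\<close>
    then have "equivalent_data S F G paraboloid_surface paraboloid_F (paraboloid_G (b / a))"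
      unfolding equivalent_data_def Let_def
      by (intro exI[of _ f] exI[of _ 1] exI[of _ 0] exI[of _ \<nu>]) simp
    then show ?thesis using front(1) by blast
  next
    case True
    \<comment> \<open>The ratio is now 0 with the roles exchanged. The parameter of the paraboloid
      is 0, and the second alternative of the equivalence is used.\<close>
    have F0: "chart_deriv c F p = 0 * chart_deriv c G p" if "c \<in> atlas S" "p \<in> fst c" for c p
      using ratio[OF that] ab True by simp
    have immG: "chart_deriv c G p \<noteq> 0" if "c \<in> atlas S" "p \<in> fst c" for c p
      using imm[OF that] F0[OF that] by auto
    note front = complete_front_proportional[OF G F immG F0 assms(2)[unfolded complete_front_commute[of S F G]]]
    then obtain f \<nu> where f: "biholomorphism S paraboloid_surface f"
      "\<forall>p\<in>points S. paraboloid_F (f p) = G p \<and> paraboloid_G 0 (f p) = F p + \<nu>" by blast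
    then have "equivalent_data S F G paraboloid_surface paraboloid_F (paraboloid_G 0)"
      unfolding equivalent_data_def Let_def
      by (intro exI[of _ f] exI[of _ 1] exI[of _ 0] exI[of _ \<nu>] conjI disjI2) simp_all
    then show ?thesis by (intro exI[of _ 0]) simp
  qed
qed

end
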